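(* Let $\Bbbk$ be a field, and let $B$ be any one of the twelve $\Bbbk$-algebras $\mathbb{A},\mathbb{B},\mathbb{D},\mathbb{E},\mathbb{G},\mathbb{K},\mathbb{L},\mathbb{Q},\mathbb{R},\mathbb{V},\mathbb{X},\mathbb{Y}$ listed in the context (for any admissible values of the parameters indicated there), presented as $B=\Bbbk\{y_1,y_2,x_1,x_2\}/\mathrm{Id}(S)$ with $S$ the corresponding set of six monic polynomials. Then $$\mathrm{Irr}(S)=\{y_1^{i_1}y_2^{i_2}x_1^{i_3}x_2^{i_4}\mid i_1,i_2,i_3,i_4\ge 0\},$$ and (the image of) this set is a $\Bbbk$-linear basis of $B$; that is, $\mathrm{Irr}(S)$ is a PBW basis of $B$.
   Context: Let $X=\{y_1,y_2,x_1,x_2\}$, $X^*$ the free monoid of words in $X$, $\Bbbk\{X\}$ the free associative unital $\Bbbk$-algebra on $X$, and $\mathrm{Id}(S)$ the two-sided ideal generated by $S\subset\Bbbk\{X\}$. Words are ordered by the degree lexicographic order (first by length, then lexicographically from left to right) with $y_1\prec y_2\prec x_1\prec x_2$; $\overline{f}$ is the largest word occurring in $f$, and $f$ is monic if that word has coefficient $1$. For a set $S$ of monic polynomials, $\mathrm{Irr}(S)=\{u\in X^*\mid u\ne a\overline{s}b \text{ for all } s\in S,\ a,b\in X^*\}$. A PBW basis of an algebra generated by $z_1,\dots,z_n$ is a $\Bbbk$-vector space basis consisting of the standard monomials $z_1^{a_1}\cdots z_n^{a_n}$, $a_i\in\mathbb{N}$; here the generators are taken in the order $y_1,y_2,x_1,x_2$.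 The algebras (each generated by $y_1,y_2,x_1,x_2$ with the given defining relations) and the sets $S$ are (the letters $\mathbb{Q},\mathbb{R}$ are names of algebras, not of number fields): $\mathbb{A}$: relations $x_2x_1=x_1x_2$, $y_2y_1=y_1y_2+y_1^2$, $y_1x_1=x_1y_1$, $y_2x_1=x_1y_2$, $y_1x_2=x_2y_1+x_1y_2$, $y_2x_2=-2x_2y_1-x_1y_2+x_2y_2$; $S=\{x_2x_1-x_1x_2,\ x_1y_1-y_1x_1,\ x_1y_2-y_2x_1,\ y_2y_1-y_1y_2-y_1^2,\ x_2y_1-y_1x_2+y_2x_1,\ x_2y_2-y_2x_2-2y_1x_2+y_2x_1\}$. $\mathbb{B}$ ($p\in\Bbbk$, $p^2=-1$): relations $x_2x_1=px_1x_2$, $y_2y_1=py_1y_2$, $y_1x_1=x_2y_2$, $y_1x_2=x_1y_2$, $y_2x_1=-x_2y_1$, $y_2x_2=x_1y_1$; $S=\{x_2x_1-px_1x_2,\ y_2y_1-py_1y_2,\ x_2y_2-y_1x_1,\ x_1y_2-y_1x_2,\ x_2y_1+y_2x_1,\ x_1y_1-y_2x_2\}$. $\mathbb{D}$ ($p\in\{-1,1\}$): relations $x_2x_1=-x_1x_2$, $y_2y_1=py_1y_2$, $y_1x_1=-px_1y_1$, $y_1x_2=-p^2x_2y_1+x_1y_2$, $y_2x_1=px_1y_2$, $y_2x_2=x_1y_1+x_2y_2$; $S=\{x_2x_1+x_1x_2,\ y_2y_1-py_1y_2,\ x_1y_1+py_1x_1,\ x_2y_1+y_1x_2-\frac1p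 y_2x_1,\ x_1y_2-\frac1p y_2x_1,\ x_2y_2-y_2x_2-py_1x_1\}$. $\mathbb{E}$ ($p\in\Bbbk$, $p^2=-1$, $\operatorname{char}\Bbbk\ne2$): relations $x_2x_1=-x_1x_2$, $y_2y_1=py_1y_2$, $y_1x_1=x_1y_2+x_2y_2$, $y_1x_2=x_1y_2-x_2y_2$, $y_2x_1=-x_1y_1+x_2y_1$, $y_2x_2=x_1y_1+x_2y_1$; $S=\{x_2x_1+x_1x_2,\ y_2y_1-py_1y_2,\ x_2y_2-\frac12y_1x_1+\frac12y_1x_2,\ x_1y_2-\frac12y_1x_1-\frac12y_1x_2,\ x_2y_1-\frac12y_2x_1-\frac12y_2x_2,\ x_1y_1+\frac12y_2x_1-\frac12y_2x_2\}$. $\mathbb{G}$ ($p,\alpha\in\Bbbk$, $p\ne0,\pm1$, $\alpha\ne0$): relations $x_2x_1=x_1x_2$, $y_2y_1=py_1y_2$, $y_1x_1=px_1y_1$, $y_2x_1=px_1y_2$, $y_1x_2=px_1y_1+p^2x_2y_1+x_1y_2$, $y_2x_2=\alpha x_1y_1-x_1y_2+x_2y_2$; $S=\{x_2x_1-x_1x_2,\ y_2y_1-py_1y_2,\ x_1y_1-\frac1py_1x_1,\ x_1y_2-\frac1py_2x_1,\ x_2y_1-\frac1{p^2}y_1x_2+\frac1{p^2}y_1x_1+\frac1{p^3}y_2x_1,\ x_2y_2+\frac{\alpha}{p}y_1x_1-\frac1py_2x_1-y_2x_2\}$. $\mathbb{K}$ ($q\in\{-1,1\}$, $\alpha\in\Bbbk$,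 $\alpha\ne0$): relations $x_2x_1=qx_1x_2$, $y_2y_1=-y_1y_2$, $y_1x_1=x_1y_1$, $y_1x_2=x_2y_2$, $y_2x_1=x_1y_2$, $y_2x_2=\alpha x_2y_1$; $S=\{x_2x_1-qx_1x_2,\ y_2y_1+y_1y_2,\ x_1y_1-y_1x_1,\ x_2y_2-y_1x_2,\ x_1y_2-y_2x_1,\ x_2y_1-\frac1\alpha y_2x_2\}$. $\mathbb{L}$ ($q\in\{-1,1\}$, $\alpha\in\Bbbk$, $\alpha\ne0$): relations $x_2x_1=qx_1x_2$, $y_2y_1=-y_1y_2$, $y_1x_1=\alpha x_1y_2$, $y_1x_2=x_2y_2$, $y_2x_1=\alpha x_1y_1$, $y_2x_2=x_2y_1$; $S=\{x_2x_1-qx_1x_2,\ y_2y_1+y_1y_2,\ x_1y_2-\frac1\alpha y_1x_1,\ x_2y_2-y_1x_2,\ x_1y_1-\frac1\alpha y_2x_1,\ x_2y_1-y_2x_2\}$. $\mathbb{Q}$: relations $x_2x_1=-x_1x_2$, $y_2y_1=-y_1y_2$, $y_1x_1=x_1y_2$, $y_2x_1=-x_1y_1$, $y_1x_2=x_1y_1+x_2y_1+x_1y_2$, $y_2x_2=x_1y_1-x_1y_2+x_2y_2$; $S=\{x_2x_1+x_1x_2,\ y_2y_1+y_1y_2,\ x_1y_2-y_1x_1,\ x_1y_1+y_2x_1,\ x_2y_1+y_1x_1-y_2x_1-y_1x_2,\ x_2y_2-y_2x_1-y_1x_1-y_2x_2\}$. $\mathbb{R}$: relations $x_2x_1=-x_1x_2$,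 $y_2y_1=-y_1y_2$, $y_1x_2=x_1y_2$, $y_2x_1=x_2y_1$, $y_1x_1=x_1y_1+x_2y_1+x_1y_2$, $y_2x_2=-x_2y_1-x_1y_2+x_2y_2$; $S=\{x_2x_1+x_1x_2,\ y_2y_1+y_1y_2,\ x_1y_2-y_1x_2,\ x_2y_1-y_2x_1,\ x_1y_1+y_2x_1+y_1x_2-y_1x_1,\ x_2y_2-y_2x_1-y_1x_2-y_2x_2\}$. $\mathbb{V}$: relations $x_2x_1=x_1x_2$, $y_2y_1=-y_1y_2$, $y_1x_2=x_2y_1$, $y_2x_2=x_2y_2$, $y_1x_1=x_2y_1+x_1y_2$, $y_2x_1=-x_1y_1+x_2y_1$; $S=\{x_2x_1-x_1x_2,\ y_2y_1+y_1y_2,\ x_2y_1-y_1x_2,\ x_2y_2-y_2x_2,\ x_1y_2+y_1x_2-y_1x_1,\ x_1y_1+y_2x_1-y_1x_2\}$. $\mathbb{X}$: relations $x_2x_1=x_1x_2$, $y_2y_1=-y_1y_2$, $y_1x_1=x_1y_2$, $y_2x_1=x_1y_1$, $y_1x_2=x_1y_2+x_2y_2$, $y_2x_2=x_1y_1+x_2y_1$; $S=\{x_2x_1-x_1x_2,\ y_2y_1+y_1y_2,\ x_1y_2-y_1x_1,\ x_1y_1-y_2x_1,\ x_2y_2+y_1x_1-y_1x_2,\ x_2y_1+y_2x_1-y_2x_2\}$. $\mathbb{Y}$ ($\alpha\in\Bbbk$): relations $x_2x_1=x_1x_2$, $y_2y_1=-y_1y_2$, $y_1x_1=x_1y_1$,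 $y_2x_1=x_1y_2$, $y_1x_2=\alpha x_1y_1-x_2y_1+x_1y_2$, $y_2x_2=x_1y_1+\alpha x_1y_2-x_2y_2$; $S=\{x_2x_1-x_1x_2,\ y_2y_1+y_1y_2,\ x_1y_1-y_1x_1,\ x_1y_2-y_2x_1,\ x_2y_1-y_2x_1-\alpha y_1x_1+y_1x_2,\ x_2y_2-y_1x_1-\alpha y_2x_1+y_2x_2\}$. *)

theory Defs
  imports
    "HOL-Library.Poly_Mapping"
    "HOL-Library.List_Lenlexorder"
    "HOL-Algebra.QuotRing"
    "Jordan_Normal_Form.VS_Connect"
begin

section \<open>Words in the alphabet \<open>X\<close>\<close>

datatype letter = Y1 | Y2 | X1 | X2

primrec letter_rank :: "letter \<Rightarrow> nat" where
  "letter_rank Y1 = 0"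
| "letter_rank Y2 = 1"
| "letter_rank X1 = 2"
| "letter_rank X2 = 3"

instantiation letter :: linorder
begin

definition less_eq_letter :: "letter \<Rightarrow> letter \<Rightarrow> bool" where
  "a \<le> b \<longleftrightarrow> letter_rank a \<le> letter_rank b"

definition less_letter :: "letter \<Rightarrow> letter \<Rightarrow> bool" where
  "a < b \<longleftrightarrow> letter_rank a < letter_rank b"

instance
proof
  fix a b :: letter
  show "a \<le> b \<Longrightarrow> b \<le> a \<Longrightarrow> a = b"
    by (cases a; cases b) (auto simp: less_eq_letter_def)
qed (auto simp: less_eq_letter_def less_letter_def)

end

text \<open>The free monoid is \<^typ>\<open>letter list\<close> under concatenation, written additively so that
  \<^typ>\<open>letter list \<Rightarrow>\<^sub>0 'k\<close> carries the convolution product of the library.  The order on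
  words is the length-first lexicographic order of \<^theory>\<open>HOL-Library.List_Lenlexorder\<close>.\<close>

instantiation list :: (type) monoid_add
begin

definition zero_list :: "'a list" where
  "0 = []"

definition plus_list :: "'a list \<Rightarrow> 'a list \<Rightarrow> 'a list" where
  "xs + ys = xs @ ys"

instance
  by standard (simp_all add: zero_list_def plus_list_def)

end


section \<open>The free associative algebra\<close>

type_synonym 'k falg = "letter list \<Rightarrow>\<^sub>0 'k"

definition scale :: "'k::field \<Rightarrow> 'k falg \<Rightarrow> 'k falg" (infixr "\<cdot>" 69) where
  "c \<cdot> f = Poly_Mapping.map (\<lambda>a. c * a) f"

definition word :: "letter list \<Rightarrow> 'k::field falg" where
  "word w = Poly_Mapping.single w 1"

definition free_algebra :: "('k::field, 'k falg) module" where
  "free_algebra = \<lparr>carrier = UNIV, mult = (*), one = 1, zero = 0, add = (+), smult = scale\<rparr>"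

definition gen_ideal :: "'k::field falg set \<Rightarrow> 'k falg set" where
  "gen_ideal S = Idl\<^bsub>free_algebra\<^esub> S"

lemma word_Nil: "word [] = 1"
  by (metis word_def zero_list_def single_one)

lemma word_append: "word (u @ v) = word u * word v"
  by (simp add: word_def mult_single plus_list_def)

lemma lookup_scale: "Poly_Mapping.lookup (c \<cdot> f) w = c * Poly_Mapping.lookup f w"
  by (simp add: scale_def Poly_Mapping.map.rep_eq when_def)

lemma scale_eq: "c \<cdot> f = Poly_Mapping.single 0 c * f"
proof -
  have "Poly_Mapping.map (\<lambda>a. c * a) f = Poly_Mapping.single 0 c * f"
    by (rule mult_map_scale_conv_mult)
  then show ?thesis
    by (simp add: scale_def)
qed

lemma ring_free_algebra: "ring (free_algebra :: ('k::field, 'k falg) module)"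
proof (rule ringI)
  show "abelian_group (free_algebra :: ('k, 'k falg) module)"
  proof (rule abelian_groupI)
    fix x :: "'k falg"
    have "- x + x = 0" by simp
    then show "\<exists>y\<in>carrier free_algebra. y \<oplus>\<^bsub>free_algebra\<^esub> x = \<zero>\<^bsub>free_algebra\<^esub>"
      by (intro bexI[of _ "- x"]) (simp_all add: free_algebra_def)
  qed (auto simp: free_algebra_def algebra_simps)
  show "Group.monoid (free_algebra :: ('k, 'k falg) module)"
    by (rule monoidI) (auto simp: free_algebra_def algebra_simps)
qed (auto simp: free_algebra_def algebra_simps)

lemma ideal_gen_ideal: "ideal (gen_ideal S) (free_algebra :: ('k::field, 'k falg) module)"
  unfolding gen_ideal_def by (rule ring.genideal_ideal[OF ring_free_algebra]) (simp add: free_algebra_def)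

definition leading_word :: "'k::field falg \<Rightarrow> letter list" where
  "leading_word f = Max (Poly_Mapping.keys f)"

definition monic :: "'k::field falg \<Rightarrow> bool" where
  "monic f \<longleftrightarrow> f \<noteq> 0 \<and> Poly_Mapping.lookup f (leading_word f) = 1"

definition Irr :: "'k::field falg set \<Rightarrow> letter list set" where
  "Irr S = {u. \<forall>s\<in>S. \<forall>a b. u \<noteq> a @ leading_word s @ b}"


section \<open>Algebras given by generators and relations\<close>

text \<open>\<open>Quot\<close> is the library's quotient ring, whose elements are cosets; only the scalar
  multiplication has to be added.\<close>

definition quotient_algebra :: "('k, 'a, 'm) module_scheme \<Rightarrow> 'a set \<Rightarrow> ('k, 'a set) module" where
  "quotient_algebra A I =
     ring.extend (A Quot I)
       (module.fields (\<lambda>c C. \<Union>f\<in>C. I +>\<^bsub>A\<^esub> (c \<odot>\<^bsub>A\<^esub> f)))"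

definition presented_algebra :: "'k::field falg set \<Rightarrow> ('k, 'k falg set) module" where
  "presented_algebra S = quotient_algebra free_algebra (gen_ideal S)"

definition proj :: "'k::field falg set \<Rightarrow> 'k falg \<Rightarrow> 'k falg set" where
  "proj S f = gen_ideal S +>\<^bsub>free_algebra\<^esub> f"

lemma proj_scale: "c \<odot>\<^bsub>presented_algebra S\<^esub> proj S f = proj S (c \<cdot> f)"
proof -
  interpret ideal "gen_ideal S" free_algebra by (rule ideal_gen_ideal)
  have "gen_ideal S +>\<^bsub>free_algebra\<^esub> (c \<cdot> g) = proj S (c \<cdot> f)" if g: "g \<in> proj S f" for g
  proof -
    obtain h where h: "h \<in> gen_ideal S" "g = h + f"
      using g by (auto simp: proj_def a_r_coset_def' free_algebra_def)
    have "Poly_Mapping.single 0 c * h \<in> gen_ideal S"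
      using I_l_closed[of h "Poly_Mapping.single 0 c"] h by (simp add: free_algebra_def)
    then have "c \<cdot> g \<in> proj S (c \<cdot> f)"
      using h by (auto simp: proj_def a_r_coset_def' free_algebra_def scale_eq algebra_simps)
    then show ?thesis
      using a_repr_independence'[of "c \<cdot> g" "c \<cdot> f"] by (simp add: proj_def free_algebra_def)
  qed
  moreover have "f \<in> proj S f"
    using a_rcos_self[of f] by (simp add: proj_def free_algebra_def)
  ultimately have "(\<Union>g\<in>proj S f. gen_ideal S +>\<^bsub>free_algebra\<^esub> (c \<cdot> g)) = proj S (c \<cdot> f)"
    by blast
  then show ?thesis
    by (simp add: presented_algebra_def quotient_algebra_def ring.extend_def module.fields_def
        FactRing_def free_algebra_def)
qed

lemma presented_algebra_simps:
  "carrier (presented_algebra S) = range (proj S)"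
  "\<one>\<^bsub>presented_algebra S\<^esub> = proj S 1"
  "\<zero>\<^bsub>presented_algebra S\<^esub> = proj S 0"
  "proj S f \<otimes>\<^bsub>presented_algebra S\<^esub> proj S g = proj S (f * g)"
  "proj S f \<oplus>\<^bsub>presented_algebra S\<^esub> proj S g = proj S (f + g)"
proof -
  interpret ideal "gen_ideal S" free_algebra by (rule ideal_gen_ideal)
  show "carrier (presented_algebra S) = range (proj S)"
    by (auto simp: presented_algebra_def quotient_algebra_def ring.extend_def module.fields_def
        FactRing_def A_RCOSETS_def' proj_def free_algebra_def)
  show "\<one>\<^bsub>presented_algebra S\<^esub> = proj S 1"
    by (simp add: presented_algebra_def quotient_algebra_def ring.extend_def module.fields_def
        FactRing_def proj_def) (simp add: free_algebra_def)
  have "gen_ideal S = proj S 0"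
    by (auto simp: proj_def a_r_coset_def' free_algebra_def)
  then show "\<zero>\<^bsub>presented_algebra S\<^esub> = proj S 0"
    by (simp add: presented_algebra_def quotient_algebra_def ring.extend_def module.fields_def
        FactRing_def)
  show "proj S f \<otimes>\<^bsub>presented_algebra S\<^esub> proj S g = proj S (f * g)"
    using rcoset_mult_add[of f g]
    by (simp add: presented_algebra_def quotient_algebra_def ring.extend_def module.fields_def
        FactRing_def proj_def) (simp add: free_algebra_def)
  show "proj S f \<oplus>\<^bsub>presented_algebra S\<^esub> proj S g = proj S (f + g)"
    using a_rcos_sum[of f g]
    by (simp add: presented_algebra_def quotient_algebra_def ring.extend_def module.fields_def
        FactRing_def proj_def) (simp add: free_algebra_def)
qed

lemma vectorspace_presented_algebra:
  "vectorspace (class_ring :: 'k::field ring) (presented_algebra (S :: 'k falg set))"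
proof -
  have "cring (class_ring :: 'k ring)"
    using class_field Ring.field.axioms(1) domain.axioms(1) by blast
  moreover have "abelian_group (presented_algebra S)"
  proof (rule abelian_groupI)
    fix x assume "x \<in> carrier (presented_algebra S)"
    then obtain f where f: "x = proj S f" by (auto simp: presented_algebra_simps)
    have "proj S (- f) \<oplus>\<^bsub>presented_algebra S\<^esub> x = \<zero>\<^bsub>presented_algebra S\<^esub>"
      by (simp add: f presented_algebra_simps)
    then show "\<exists>y\<in>carrier (presented_algebra S).
        y \<oplus>\<^bsub>presented_algebra S\<^esub> x = \<zero>\<^bsub>presented_algebra S\<^esub>"
      by (auto simp: presented_algebra_simps(1))
  qed (auto simp: presented_algebra_simps add.assoc add.commute add.left_commute)
  ultimately have "Module.module (class_ring :: 'k ring) (presented_algebra S)"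
    by (rule moduleI)
      (auto simp: presented_algebra_simps proj_scale scale_eq class_ring_simps
        algebra_simps single_add mult_single simp flip: mult.assoc)
  then show ?thesis
    using class_field by (simp add: vectorspace_def)
qed

definition standard_monomial :: "('a, 'm) ring_scheme \<Rightarrow> 'a list \<Rightarrow> nat list \<Rightarrow> 'a" where
  "standard_monomial B zs as =
     foldr (\<lambda>u v. u \<otimes>\<^bsub>B\<^esub> v) (map2 (\<lambda>z a. z [^]\<^bsub>B\<^esub> a) zs as) \<one>\<^bsub>B\<^esub>"

text \<open>\<open>M\<close> is the set of standard monomials, it is a basis, and distinct exponents give distinct
  monomials, so that no linear relation is hidden in a coincidence of two monomials.\<close>

definition PBW_basis :: "('k::field, 'a, 'm) module_scheme \<Rightarrow> 'a list \<Rightarrow> 'a set \<Rightarrow> bool" where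
  "PBW_basis B zs M \<longleftrightarrow>
     M = standard_monomial B zs ` {as. length as = length zs} \<and>
     inj_on (standard_monomial B zs) {as. length as = length zs} \<and>
     vectorspace.basis (class_ring :: 'k ring) B M"


section \<open>The twelve families\<close>

datatype 'k family =
    FamA | FamB 'k | FamD 'k | FamE 'k | FamG 'k 'k | FamK 'k 'k | FamL 'k 'k
  | FamQ | FamR | FamV | FamX | FamY 'k

fun admissible :: "'k::field family \<Rightarrow> bool" where
  "admissible FamA \<longleftrightarrow> True"
| "admissible (FamB p) \<longleftrightarrow> p ^ 2 = - 1"
| "admissible (FamD p) \<longleftrightarrow> p \<in> {- 1, 1}"
| "admissible (FamE p) \<longleftrightarrow> p ^ 2 = - 1 \<and> (2::'k) \<noteq> 0"
| "admissible (FamG p \<alpha>) \<longleftrightarrow> p \<noteq> 0 \<and> p \<noteq> 1 \<and> p \<noteq> - 1 \<and> \<alpha> \<noteq> 0"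
| "admissible (FamK q \<alpha>) \<longleftrightarrow> q \<in> {- 1, 1} \<and> \<alpha> \<noteq> 0"
| "admissible (FamL q \<alpha>) \<longleftrightarrow> q \<in> {- 1, 1} \<and> \<alpha> \<noteq> 0"
| "admissible FamQ \<longleftrightarrow> True"
| "admissible FamR \<longleftrightarrow> True"
| "admissible FamV \<longleftrightarrow> True"
| "admissible FamX \<longleftrightarrow> True"
| "admissible (FamY \<alpha>) \<longleftrightarrow> True"

abbreviation y\<^sub>1 :: "'k::field falg" where "y\<^sub>1 \<equiv> word [Y1]"
abbreviation y\<^sub>2 :: "'k::field falg" where "y\<^sub>2 \<equiv> word [Y2]"
abbreviation x\<^sub>1 :: "'k::field falg" where "x\<^sub>1 \<equiv> word [X1]"
abbreviation x\<^sub>2 :: "'k::field falg" where "x\<^sub>2 \<equiv> word [X2]"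

text \<open>A relation \<open>l = r\<close> is recorded as \<open>l - (r)\<close>.  The scalar multiplication \<open>\<cdot>\<close> binds weaker
  than the product.\<close>

fun defining_relations :: "'k::field family \<Rightarrow> 'k falg set" where
  "defining_relations FamA =
    {x\<^sub>2 * x\<^sub>1 - (x\<^sub>1 * x\<^sub>2),
     y\<^sub>2 * y\<^sub>1 - (y\<^sub>1 * y\<^sub>2 + y\<^sub>1 ^ 2),
     y\<^sub>1 * x\<^sub>1 - (x\<^sub>1 * y\<^sub>1),
     y\<^sub>2 * x\<^sub>1 - (x\<^sub>1 * y\<^sub>2),
     y\<^sub>1 * x\<^sub>2 - (x\<^sub>2 * y\<^sub>1 + x\<^sub>1 * y\<^sub>2),
     y\<^sub>2 * x\<^sub>2 - ((- 2) \<cdot> x\<^sub>2 * y\<^sub>1 - x\<^sub>1 * y\<^sub>2 + x\<^sub>2 * y\<^sub>2)}"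
| "defining_relations (FamB p) =
    {x\<^sub>2 * x\<^sub>1 - (p \<cdot> x\<^sub>1 * x\<^sub>2),
     y\<^sub>2 * y\<^sub>1 - (p \<cdot> y\<^sub>1 * y\<^sub>2),
     y\<^sub>1 * x\<^sub>1 - (x\<^sub>2 * y\<^sub>2),
     y\<^sub>1 * x\<^sub>2 - (x\<^sub>1 * y\<^sub>2),
     y\<^sub>2 * x\<^sub>1 - (- (x\<^sub>2 * y\<^sub>1)),
     y\<^sub>2 * x\<^sub>2 - (x\<^sub>1 * y\<^sub>1)}"
| "defining_relations (FamD p) =
    {x\<^sub>2 * x\<^sub>1 - (- (x\<^sub>1 * x\<^sub>2)),
     y\<^sub>2 * y\<^sub>1 - (p \<cdot> y\<^sub>1 * y\<^sub>2),
     y\<^sub>1 * x\<^sub>1 - ((- p) \<cdot> x\<^sub>1 * y\<^sub>1),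
     y\<^sub>1 * x\<^sub>2 - ((- (p ^ 2)) \<cdot> x\<^sub>2 * y\<^sub>1 + x\<^sub>1 * y\<^sub>2),
     y\<^sub>2 * x\<^sub>1 - (p \<cdot> x\<^sub>1 * y\<^sub>2),
     y\<^sub>2 * x\<^sub>2 - (x\<^sub>1 * y\<^sub>1 + x\<^sub>2 * y\<^sub>2)}"
| "defining_relations (FamE p) =
    {x\<^sub>2 * x\<^sub>1 - (- (x\<^sub>1 * x\<^sub>2)),
     y\<^sub>2 * y\<^sub>1 - (p \<cdot> y\<^sub>1 * y\<^sub>2),
     y\<^sub>1 * x\<^sub>1 - (x\<^sub>1 * y\<^sub>2 + x\<^sub>2 * y\<^sub>2),
     y\<^sub>1 * x\<^sub>2 - (x\<^sub>1 * y\<^sub>2 - x\<^sub>2 * y\<^sub>2),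
     y\<^sub>2 * x\<^sub>1 - (- (x\<^sub>1 * y\<^sub>1) + x\<^sub>2 * y\<^sub>1),
     y\<^sub>2 * x\<^sub>2 - (x\<^sub>1 * y\<^sub>1 + x\<^sub>2 * y\<^sub>1)}"
| "defining_relations (FamG p \<alpha>) =
    {x\<^sub>2 * x\<^sub>1 - (x\<^sub>1 * x\<^sub>2),
     y\<^sub>2 * y\<^sub>1 - (p \<cdot> y\<^sub>1 * y\<^sub>2),
     y\<^sub>1 * x\<^sub>1 - (p \<cdot> x\<^sub>1 * y\<^sub>1),
     y\<^sub>2 * x\<^sub>1 - (p \<cdot> x\<^sub>1 * y\<^sub>2),
     y\<^sub>1 * x\<^sub>2 - (p \<cdot> x\<^sub>1 * y\<^sub>1 + p ^ 2 \<cdot> x\<^sub>2 * y\<^sub>1 + x\<^sub>1 * y\<^sub>2),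
     y\<^sub>2 * x\<^sub>2 - (\<alpha> \<cdot> x\<^sub>1 * y\<^sub>1 - x\<^sub>1 * y\<^sub>2 + x\<^sub>2 * y\<^sub>2)}"
| "defining_relations (FamK q \<alpha>) =
    {x\<^sub>2 * x\<^sub>1 - (q \<cdot> x\<^sub>1 * x\<^sub>2),
     y\<^sub>2 * y\<^sub>1 - (- (y\<^sub>1 * y\<^sub>2)),
     y\<^sub>1 * x\<^sub>1 - (x\<^sub>1 * y\<^sub>1),
     y\<^sub>1 * x\<^sub>2 - (x\<^sub>2 * y\<^sub>2),
     y\<^sub>2 * x\<^sub>1 - (x\<^sub>1 * y\<^sub>2),
     y\<^sub>2 * x\<^sub>2 - (\<alpha> \<cdot> x\<^sub>2 * y\<^sub>1)}"
| "defining_relations (FamL q \<alpha>) =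
    {x\<^sub>2 * x\<^sub>1 - (q \<cdot> x\<^sub>1 * x\<^sub>2),
     y\<^sub>2 * y\<^sub>1 - (- (y\<^sub>1 * y\<^sub>2)),
     y\<^sub>1 * x\<^sub>1 - (\<alpha> \<cdot> x\<^sub>1 * y\<^sub>2),
     y\<^sub>1 * x\<^sub>2 - (x\<^sub>2 * y\<^sub>2),
     y\<^sub>2 * x\<^sub>1 - (\<alpha> \<cdot> x\<^sub>1 * y\<^sub>1),
     y\<^sub>2 * x\<^sub>2 - (x\<^sub>2 * y\<^sub>1)}"
| "defining_relations FamQ =
    {x\<^sub>2 * x\<^sub>1 - (- (x\<^sub>1 * x\<^sub>2)),
     y\<^sub>2 * y\<^sub>1 - (- (y\<^sub>1 * y\<^sub>2)),
     y\<^sub>1 * x\<^sub>1 - (x\<^sub>1 * y\<^sub>2),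
     y\<^sub>2 * x\<^sub>1 - (- (x\<^sub>1 * y\<^sub>1)),
     y\<^sub>1 * x\<^sub>2 - (x\<^sub>1 * y\<^sub>1 + x\<^sub>2 * y\<^sub>1 + x\<^sub>1 * y\<^sub>2),
     y\<^sub>2 * x\<^sub>2 - (x\<^sub>1 * y\<^sub>1 - x\<^sub>1 * y\<^sub>2 + x\<^sub>2 * y\<^sub>2)}"
| "defining_relations FamR =
    {x\<^sub>2 * x\<^sub>1 - (- (x\<^sub>1 * x\<^sub>2)),
     y\<^sub>2 * y\<^sub>1 - (- (y\<^sub>1 * y\<^sub>2)),
     y\<^sub>1 * x\<^sub>2 - (x\<^sub>1 * y\<^sub>2),
     y\<^sub>2 * x\<^sub>1 - (x\<^sub>2 * y\<^sub>1),
     y\<^sub>1 * x\<^sub>1 - (x\<^sub>1 * y\<^sub>1 + x\<^sub>2 * y\<^sub>1 + x\<^sub>1 * y\<^sub>2),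
     y\<^sub>2 * x\<^sub>2 - (- (x\<^sub>2 * y\<^sub>1) - x\<^sub>1 * y\<^sub>2 + x\<^sub>2 * y\<^sub>2)}"
| "defining_relations FamV =
    {x\<^sub>2 * x\<^sub>1 - (x\<^sub>1 * x\<^sub>2),
     y\<^sub>2 * y\<^sub>1 - (- (y\<^sub>1 * y\<^sub>2)),
     y\<^sub>1 * x\<^sub>2 - (x\<^sub>2 * y\<^sub>1),
     y\<^sub>2 * x\<^sub>2 - (x\<^sub>2 * y\<^sub>2),
     y\<^sub>1 * x\<^sub>1 - (x\<^sub>2 * y\<^sub>1 + x\<^sub>1 * y\<^sub>2),
     y\<^sub>2 * x\<^sub>1 - (- (x\<^sub>1 * y\<^sub>1) + x\<^sub>2 * y\<^sub>1)}"
| "defining_relations FamX =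
    {x\<^sub>2 * x\<^sub>1 - (x\<^sub>1 * x\<^sub>2),
     y\<^sub>2 * y\<^sub>1 - (- (y\<^sub>1 * y\<^sub>2)),
     y\<^sub>1 * x\<^sub>1 - (x\<^sub>1 * y\<^sub>2),
     y\<^sub>2 * x\<^sub>1 - (x\<^sub>1 * y\<^sub>1),
     y\<^sub>1 * x\<^sub>2 - (x\<^sub>1 * y\<^sub>2 + x\<^sub>2 * y\<^sub>2),
     y\<^sub>2 * x\<^sub>2 - (x\<^sub>1 * y\<^sub>1 + x\<^sub>2 * y\<^sub>1)}"
| "defining_relations (FamY \<alpha>) =
    {x\<^sub>2 * x\<^sub>1 - (x\<^sub>1 * x\<^sub>2),
     y\<^sub>2 * y\<^sub>1 - (- (y\<^sub>1 * y\<^sub>2)),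
     y\<^sub>1 * x\<^sub>1 - (x\<^sub>1 * y\<^sub>1),
     y\<^sub>2 * x\<^sub>1 - (x\<^sub>1 * y\<^sub>2),
     y\<^sub>1 * x\<^sub>2 - (\<alpha> \<cdot> x\<^sub>1 * y\<^sub>1 - x\<^sub>2 * y\<^sub>1 + x\<^sub>1 * y\<^sub>2),
     y\<^sub>2 * x\<^sub>2 - (x\<^sub>1 * y\<^sub>1 + \<alpha> \<cdot> x\<^sub>1 * y\<^sub>2 - x\<^sub>2 * y\<^sub>2)}"

fun S_set :: "'k::field family \<Rightarrow> 'k falg set" where
  "S_set FamA =
    {x\<^sub>2 * x\<^sub>1 - x\<^sub>1 * x\<^sub>2,
     x\<^sub>1 * y\<^sub>1 - y\<^sub>1 * x\<^sub>1,
     x\<^sub>1 * y\<^sub>2 - y\<^sub>2 * x\<^sub>1,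
     y\<^sub>2 * y\<^sub>1 - y\<^sub>1 * y\<^sub>2 - y\<^sub>1 ^ 2,
     x\<^sub>2 * y\<^sub>1 - y\<^sub>1 * x\<^sub>2 + y\<^sub>2 * x\<^sub>1,
     x\<^sub>2 * y\<^sub>2 - y\<^sub>2 * x\<^sub>2 - 2 \<cdot> y\<^sub>1 * x\<^sub>2 + y\<^sub>2 * x\<^sub>1}"
| "S_set (FamB p) =
    {x\<^sub>2 * x\<^sub>1 - p \<cdot> x\<^sub>1 * x\<^sub>2,
     y\<^sub>2 * y\<^sub>1 - p \<cdot> y\<^sub>1 * y\<^sub>2,
     x\<^sub>2 * y\<^sub>2 - y\<^sub>1 * x\<^sub>1,
     x\<^sub>1 * y\<^sub>2 - y\<^sub>1 * x\<^sub>2,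
     x\<^sub>2 * y\<^sub>1 + y\<^sub>2 * x\<^sub>1,
     x\<^sub>1 * y\<^sub>1 - y\<^sub>2 * x\<^sub>2}"
| "S_set (FamD p) =
    {x\<^sub>2 * x\<^sub>1 + x\<^sub>1 * x\<^sub>2,
     y\<^sub>2 * y\<^sub>1 - p \<cdot> y\<^sub>1 * y\<^sub>2,
     x\<^sub>1 * y\<^sub>1 + p \<cdot> y\<^sub>1 * x\<^sub>1,
     x\<^sub>2 * y\<^sub>1 + y\<^sub>1 * x\<^sub>2 - (1 / p) \<cdot> y\<^sub>2 * x\<^sub>1,
     x\<^sub>1 * y\<^sub>2 - (1 / p) \<cdot> y\<^sub>2 * x\<^sub>1,
     x\<^sub>2 * y\<^sub>2 - y\<^sub>2 * x\<^sub>2 - p \<cdot> y\<^sub>1 * x\<^sub>1}"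
| "S_set (FamE p) =
    {x\<^sub>2 * x\<^sub>1 + x\<^sub>1 * x\<^sub>2,
     y\<^sub>2 * y\<^sub>1 - p \<cdot> y\<^sub>1 * y\<^sub>2,
     x\<^sub>2 * y\<^sub>2 - (1 / 2) \<cdot> y\<^sub>1 * x\<^sub>1 + (1 / 2) \<cdot> y\<^sub>1 * x\<^sub>2,
     x\<^sub>1 * y\<^sub>2 - (1 / 2) \<cdot> y\<^sub>1 * x\<^sub>1 - (1 / 2) \<cdot> y\<^sub>1 * x\<^sub>2,
     x\<^sub>2 * y\<^sub>1 - (1 / 2) \<cdot> y\<^sub>2 * x\<^sub>1 - (1 / 2) \<cdot> y\<^sub>2 * x\<^sub>2,
     x\<^sub>1 * y\<^sub>1 + (1 / 2) \<cdot> y\<^sub>2 * x\<^sub>1 - (1 / 2) \<cdot> y\<^sub>2 * x\<^sub>2}"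
| "S_set (FamG p \<alpha>) =
    {x\<^sub>2 * x\<^sub>1 - x\<^sub>1 * x\<^sub>2,
     y\<^sub>2 * y\<^sub>1 - p \<cdot> y\<^sub>1 * y\<^sub>2,
     x\<^sub>1 * y\<^sub>1 - (1 / p) \<cdot> y\<^sub>1 * x\<^sub>1,
     x\<^sub>1 * y\<^sub>2 - (1 / p) \<cdot> y\<^sub>2 * x\<^sub>1,
     x\<^sub>2 * y\<^sub>1 - (1 / p ^ 2) \<cdot> y\<^sub>1 * x\<^sub>2 + (1 / p ^ 2) \<cdot> y\<^sub>1 * x\<^sub>1 + (1 / p ^ 3) \<cdot> y\<^sub>2 * x\<^sub>1,
     x\<^sub>2 * y\<^sub>2 + (\<alpha> / p) \<cdot> y\<^sub>1 * x\<^sub>1 - (1 / p) \<cdot> y\<^sub>2 * x\<^sub>1 - y\<^sub>2 * x\<^sub>2}"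
| "S_set (FamK q \<alpha>) =
    {x\<^sub>2 * x\<^sub>1 - q \<cdot> x\<^sub>1 * x\<^sub>2,
     y\<^sub>2 * y\<^sub>1 + y\<^sub>1 * y\<^sub>2,
     x\<^sub>1 * y\<^sub>1 - y\<^sub>1 * x\<^sub>1,
     x\<^sub>2 * y\<^sub>2 - y\<^sub>1 * x\<^sub>2,
     x\<^sub>1 * y\<^sub>2 - y\<^sub>2 * x\<^sub>1,
     x\<^sub>2 * y\<^sub>1 - (1 / \<alpha>) \<cdot> y\<^sub>2 * x\<^sub>2}"
| "S_set (FamL q \<alpha>) =
    {x\<^sub>2 * x\<^sub>1 - q \<cdot> x\<^sub>1 * x\<^sub>2,
     y\<^sub>2 * y\<^sub>1 + y\<^sub>1 * y\<^sub>2,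
     x\<^sub>1 * y\<^sub>2 - (1 / \<alpha>) \<cdot> y\<^sub>1 * x\<^sub>1,
     x\<^sub>2 * y\<^sub>2 - y\<^sub>1 * x\<^sub>2,
     x\<^sub>1 * y\<^sub>1 - (1 / \<alpha>) \<cdot> y\<^sub>2 * x\<^sub>1,
     x\<^sub>2 * y\<^sub>1 - y\<^sub>2 * x\<^sub>2}"
| "S_set FamQ =
    {x\<^sub>2 * x\<^sub>1 + x\<^sub>1 * x\<^sub>2,
     y\<^sub>2 * y\<^sub>1 + y\<^sub>1 * y\<^sub>2,
     x\<^sub>1 * y\<^sub>2 - y\<^sub>1 * x\<^sub>1,
     x\<^sub>1 * y\<^sub>1 + y\<^sub>2 * x\<^sub>1,
     x\<^sub>2 * y\<^sub>1 + y\<^sub>1 * x\<^sub>1 - y\<^sub>2 * x\<^sub>1 - y\<^sub>1 * x\<^sub>2,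
     x\<^sub>2 * y\<^sub>2 - y\<^sub>2 * x\<^sub>1 - y\<^sub>1 * x\<^sub>1 - y\<^sub>2 * x\<^sub>2}"
| "S_set FamR =
    {x\<^sub>2 * x\<^sub>1 + x\<^sub>1 * x\<^sub>2,
     y\<^sub>2 * y\<^sub>1 + y\<^sub>1 * y\<^sub>2,
     x\<^sub>1 * y\<^sub>2 - y\<^sub>1 * x\<^sub>2,
     x\<^sub>2 * y\<^sub>1 - y\<^sub>2 * x\<^sub>1,
     x\<^sub>1 * y\<^sub>1 + y\<^sub>2 * x\<^sub>1 + y\<^sub>1 * x\<^sub>2 - y\<^sub>1 * x\<^sub>1,
     x\<^sub>2 * y\<^sub>2 - y\<^sub>2 * x\<^sub>1 - y\<^sub>1 * x\<^sub>2 - y\<^sub>2 * x\<^sub>2}"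
| "S_set FamV =
    {x\<^sub>2 * x\<^sub>1 - x\<^sub>1 * x\<^sub>2,
     y\<^sub>2 * y\<^sub>1 + y\<^sub>1 * y\<^sub>2,
     x\<^sub>2 * y\<^sub>1 - y\<^sub>1 * x\<^sub>2,
     x\<^sub>2 * y\<^sub>2 - y\<^sub>2 * x\<^sub>2,
     x\<^sub>1 * y\<^sub>2 + y\<^sub>1 * x\<^sub>2 - y\<^sub>1 * x\<^sub>1,
     x\<^sub>1 * y\<^sub>1 + y\<^sub>2 * x\<^sub>1 - y\<^sub>1 * x\<^sub>2}"
| "S_set FamX =
    {x\<^sub>2 * x\<^sub>1 - x\<^sub>1 * x\<^sub>2,
     y\<^sub>2 * y\<^sub>1 + y\<^sub>1 * y\<^sub>2,
     x\<^sub>1 * y\<^sub>2 - y\<^sub>1 * x\<^sub>1,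
     x\<^sub>1 * y\<^sub>1 - y\<^sub>2 * x\<^sub>1,
     x\<^sub>2 * y\<^sub>2 + y\<^sub>1 * x\<^sub>1 - y\<^sub>1 * x\<^sub>2,
     x\<^sub>2 * y\<^sub>1 + y\<^sub>2 * x\<^sub>1 - y\<^sub>2 * x\<^sub>2}"
| "S_set (FamY \<alpha>) =
    {x\<^sub>2 * x\<^sub>1 - x\<^sub>1 * x\<^sub>2,
     y\<^sub>2 * y\<^sub>1 + y\<^sub>1 * y\<^sub>2,
     x\<^sub>1 * y\<^sub>1 - y\<^sub>1 * x\<^sub>1,
     x\<^sub>1 * y\<^sub>2 - y\<^sub>2 * x\<^sub>1,
     x\<^sub>2 * y\<^sub>1 - y\<^sub>2 * x\<^sub>1 - \<alpha> \<cdot> y\<^sub>1 * x\<^sub>1 + y\<^sub>1 * x\<^sub>2,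
     x\<^sub>2 * y\<^sub>2 - y\<^sub>1 * x\<^sub>1 - \<alpha> \<cdot> y\<^sub>2 * x\<^sub>1 + y\<^sub>2 * x\<^sub>2}"

end

theory Submission
  imports Defs
begin

text \<open>Why the theorem holds.  In each of the twelve sets \<open>S\<close> the six leading words are exactly
  the descents \<open>ab\<close> with \<open>b < a\<close>: every pair of letters in the wrong order.  A word is therefore
  irreducible iff it is sorted, and sorted words are the words
  \<open>y\<^sub>1\<^sup>i y\<^sub>2\<^sup>j x\<^sub>1\<^sup>k x\<^sub>2\<^sup>l\<close>.  That the sorted words form a basis is the diamond lemma
  (\<open>nf_rewrite\<close>): if the two ways of straightening each word \<open>cba\<close> with \<open>a < b < c\<close> agree, then
  replacing descents until none is left defines a linear normal form map that is independent of
  the choices.  It kills the ideal (\<open>nf_gen_ideal\<close>), fixes sorted words, and changes a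
  polynomial only by an element of the ideal (\<open>minus_nf\<close>); this gives linear independence and
  spanning.

  The ambiguities are treated for all families at once.  Each algebra is glued from a quadratic
  algebra in \<open>y\<^sub>1, y\<^sub>2\<close> with \<open>y\<^sub>2y\<^sub>1 = p\<^sub>1y\<^sub>1y\<^sub>2 + p\<^sub>2y\<^sub>1\<^sup>2\<close> and one in \<open>x\<^sub>1, x\<^sub>2\<close> with
  \<open>x\<^sub>2x\<^sub>1 = q x\<^sub>1x\<^sub>2\<close> by a \<open>4 \<times> 4\<close> matrix \<open>m\<close> that turns each \<open>x\<^sub>i y\<^sub>j\<close> into a combination of the
  \<open>y\<^sub>k x\<^sub>l\<close>.  The overlaps \<open>x\<^sub>2x\<^sub>1y\<^sub>j\<close> and \<open>x\<^sub>iy\<^sub>2y\<^sub>1\<close> resolve as soon as pushing the relation of the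
  \<open>x\<close>s to the right through \<open>y\<^sub>j\<close>, and that of the \<open>y\<close>s to the left through \<open>x\<^sub>i\<close>, gives the same
  relation again; this is a list of quadratic identities between the entries of \<open>m\<close>
  (locale \<open>twisted_product\<close>).  The defining relations express the \<open>y\<^sub>k x\<^sub>l\<close> through the
  \<open>x\<^sub>i y\<^sub>j\<close> by the inverse matrix, hence generate the same ideal (\<open>gen_ideal_exchanging\<close>).  What
  remains for each family is arithmetic in the field with two \<open>4 \<times> 4\<close> tables.\<close>

section \<open>Linear maps on the free algebra\<close>

interpretation falg: vector_space "scale :: 'k::field \<Rightarrow> 'k falg \<Rightarrow> 'k falg"
  by unfold_locales
    (auto intro!: poly_mapping_eqI simp: lookup_scale lookup_add algebra_simps)

abbreviation flinear :: "('k::field falg \<Rightarrow> 'k falg) \<Rightarrow> bool" where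
  "flinear \<equiv> Vector_Spaces.linear scale scale"

lemma flinearI:
  assumes "\<And>f g. \<phi> (f + g) = \<phi> f + \<phi> g" "\<And>c f. \<phi> (c \<cdot> f) = c \<cdot> \<phi> f"
  shows "flinear \<phi>"
  using assms by (simp add: Vector_Spaces.linear_iff falg.vector_space_axioms)

lemma flinear_add: "flinear \<phi> \<Longrightarrow> \<phi> (f + g) = \<phi> f + \<phi> g"
  and flinear_scale: "flinear \<phi> \<Longrightarrow> \<phi> (c \<cdot> f) = c \<cdot> \<phi> f"
  by (simp_all add: Vector_Spaces.linear_iff)

lemma flinear_diff: "flinear \<phi> \<Longrightarrow> \<phi> (f - g) = \<phi> f - \<phi> g"
  by (metis add_diff_cancel_right' diff_add_cancel flinear_add)

lemma flinear_zero: "flinear \<phi> \<Longrightarrow> \<phi> 0 = 0"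
  using flinear_diff[of \<phi> 0 0] by simp

lemma flinear_sum: "flinear \<phi> \<Longrightarrow> \<phi> (\<Sum>i\<in>I. f i) = (\<Sum>i\<in>I. \<phi> (f i))"
  by (induction I rule: infinite_finite_induct) (auto simp: flinear_zero flinear_add)

lemma scale_mult_left: "(c \<cdot> f) * g = c \<cdot> (f * g)"
  by (simp add: scale_eq mult.assoc)

lemma keys_word [simp]: "Poly_Mapping.keys (word w :: 'k::field falg) = {w}"
  by (simp add: word_def)

lemma lookup_word: "Poly_Mapping.lookup (word w) v = (1 when v = w)"
  by (auto simp: word_def lookup_single when_def)

text \<open>The linear map with prescribed values on words.  As \<open>f\<close> has finite support, \<open>g\<close> is only
  evaluated on the words of \<open>f\<close>; the congruence rule below makes this visible, which is what lets
  the normal form be defined by well-founded recursion.\<close>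

definition extend :: "(letter list \<Rightarrow> 'k::field falg) \<Rightarrow> 'k falg \<Rightarrow> 'k falg" where
  "extend g f = (\<Sum>w\<in>Poly_Mapping.keys f. Poly_Mapping.lookup f w \<cdot> g w)"

lemma extend_cong [fundef_cong]:
  "f = f' \<Longrightarrow> (\<And>w. w \<in> Poly_Mapping.keys f' \<Longrightarrow> g w = g' w) \<Longrightarrow> extend g f = extend g' f'"
  by (simp add: extend_def)

lemma extend_superset:
  assumes "finite W" "Poly_Mapping.keys f \<subseteq> W"
  shows "extend g f = (\<Sum>w\<in>W. Poly_Mapping.lookup f w \<cdot> g w)"
  unfolding extend_def by (rule sum.mono_neutral_left) (use assms in \<open>auto simp: in_keys_iff\<close>)

lemma flinear_extend: "flinear (extend g)"
proof (rule flinearI)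
  fix f h :: "'a falg" and c
  let ?W = "Poly_Mapping.keys f \<union> Poly_Mapping.keys h"
  have "Poly_Mapping.keys (f + h) \<subseteq> ?W" by (rule keys_add)
  then show "extend g (f + h) = extend g f + extend g h"
    by (simp add: extend_superset[of ?W] lookup_add falg.scale_left_distrib sum.distrib)
  have "Poly_Mapping.keys (c \<cdot> f) \<subseteq> Poly_Mapping.keys f"
    by (auto simp: in_keys_iff lookup_scale)
  then show "extend g (c \<cdot> f) = c \<cdot> extend g f"
    by (simp add: extend_superset[of "Poly_Mapping.keys f"] lookup_scale falg.scale_sum_right)
qed

lemma extend_word [simp]: "extend g (word w) = g w"
  by (simp add: extend_def lookup_word)

lemma extend_word_id: "extend word f = f"
proof (rule poly_mapping_eqI)
  fix v
  show "Poly_Mapping.lookup (extend word f) v = Poly_Mapping.lookup f v"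
    by (cases "v \<in> Poly_Mapping.keys f")
      (auto simp: extend_def lookup_sum lookup_scale lookup_word when_def in_keys_iff
        if_distrib[of "\<lambda>x. _ * x"] cong: if_cong)
qed

text \<open>The scalars are central although the algebra is not commutative; multiplying
  single words shows it.\<close>

lemma scale_mult_right: "f * (c \<cdot> g) = c \<cdot> (f * g)"
proof -
  have "extend word f * Poly_Mapping.single 0 c = Poly_Mapping.single 0 c * extend word f"
    by (simp add: extend_def scale_eq word_def sum_distrib_left sum_distrib_right mult_single
        mult.commute)
  then show ?thesis by (simp add: extend_word_id scale_eq flip: mult.assoc)
qed

lemma flinear_sandwich: "flinear \<phi> \<Longrightarrow> flinear (\<lambda>f. \<phi> (g * f * h))"
  by (intro flinearI)
    (simp_all add: flinear_add flinear_scale scale_mult_left scale_mult_right algebra_simps)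

lemma flinear_eq_on_keys:
  assumes "flinear \<phi>" "flinear \<psi>" "\<And>w. w \<in> Poly_Mapping.keys f \<Longrightarrow> \<phi> (word w) = \<psi> (word w)"
  shows "\<phi> f = \<psi> f"
proof -
  have "\<phi> (extend word f) = \<psi> (extend word f)"
    unfolding extend_def by (simp add: flinear_sum flinear_scale assms)
  then show ?thesis by (simp add: extend_word_id)
qed

section \<open>Words\<close>

text \<open>The degree lexicographic order is a monomial order.  Only words of equal length are compared,
  since all relations are homogeneous.\<close>

lemma append_less_append:
  fixes s t p q :: "'a::order list"
  assumes "length s = length t" "s < t"
  shows "p @ s @ q < p @ t @ q"
proof -
  have "s @ q < t @ q"
    using assms by (induction s t rule: list_induct2) (auto simp: Cons_less_Cons)
  then show ?thesis
    using assms(1) by (induction p) (auto simp: Cons_less_Cons)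
qed

text \<open>A word with an inversion has one between neighbours, so forbidding the six leading words
  forbids every inversion.\<close>

lemma sorted_iff_no_descent:
  "sorted w \<longleftrightarrow> (\<nexists>u a b v. w = u @ [a, b] @ v \<and> b < (a :: 'a::linorder))"
proof
  assume "sorted w"
  then show "\<nexists>u a b v. w = u @ [a, b] @ v \<and> b < a"
    by (auto simp: sorted_append)
next
  show "\<nexists>u a b v. w = u @ [a, b] @ v \<and> b < a \<Longrightarrow> sorted w"
  proof (induction w)
    case (Cons x w)
    have "sorted w"
      using Cons.prems by (intro Cons.IH) (metis append_Cons)
    show ?case
    proof (cases w)
      case (Cons y v)
      have "x # w = [] @ [x, y] @ v" by (simp add: Cons)
      then have "x \<le> y" using \<open>\<nexists>u a b v. x # w = u @ [a, b] @ v \<and> b < a\<close> by (metis not_less)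
      then show ?thesis using \<open>sorted w\<close> by (auto simp: Cons)
    qed simp
  qed simp
qed

lemma sorted_letter_iff:
  "sorted w \<longleftrightarrow> (\<exists>i j k l. w = replicate i Y1 @ replicate j Y2 @ replicate k X1 @ replicate l X2)"
proof
  show "\<exists>i j k l. w = replicate i Y1 @ replicate j Y2 @ replicate k X1 @ replicate l X2"
    if "sorted w"
    using that
  proof (induction w)
    case (Cons x w)
    then obtain i j k l where w: "w = replicate i Y1 @ replicate j Y2 @ replicate k X1 @ replicate l X2"
      by auto
    have "\<forall>y\<in>set w. x \<le> y" using Cons.prems by simp
    then consider "x = Y1" | "x = Y2" "i = 0" | "x = X1" "i = 0" "j = 0"
      | "x = X2" "i = 0" "j = 0" "k = 0"
      unfolding w by (cases x) (auto simp: less_eq_letter_def set_replicate_conv_if split: if_splits)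
    then show ?case
    proof cases
      case 1
      then have "x # w = replicate (Suc i) Y1 @ replicate j Y2 @ replicate k X1 @ replicate l X2"
        by (simp add: w)
      then show ?thesis by blast
    next
      case 2
      then have "x # w = replicate 0 Y1 @ replicate (Suc j) Y2 @ replicate k X1 @ replicate l X2"
        by (simp add: w)
      then show ?thesis by blast
    next
      case 3
      then have "x # w = replicate 0 Y1 @ replicate 0 Y2 @ replicate (Suc k) X1 @ replicate l X2"
        by (simp add: w)
      then show ?thesis by blast
    next
      case 4
      then have "x # w = replicate 0 Y1 @ replicate 0 Y2 @ replicate 0 X1 @ replicate (Suc l) X2"
        by (simp add: w)
      then show ?thesis by blast
    qed
  qed (auto intro: exI[of _ 0])
qed (auto simp: sorted_append less_eq_letter_def)

text \<open>With letters well-ordered, so are words; rewriting to smaller words therefore terminates.\<close>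

instance letter :: wellorder
proof
  fix P :: "letter \<Rightarrow> bool" and a
  assume step: "\<And>x. (\<And>y. y < x \<Longrightarrow> P y) \<Longrightarrow> P x"
  show "P a"
    by (induction a rule: measure_induct_rule[of letter_rank]) (rule step, simp add: less_letter_def)
qed

abbreviation YX :: "(letter \<times> letter) set" where
  "YX \<equiv> {(Y1, X1), (Y1, X2), (Y2, X1), (Y2, X2)}"

abbreviation XY :: "(letter \<times> letter) set" where
  "XY \<equiv> {(X1, Y1), (X1, Y2), (X2, Y1), (X2, Y2)}"

lemma descents: "{(a, b). b < a} = {(X2, X1), (Y2, Y1)} \<union> XY"
proof -
  have "b < a \<longleftrightarrow> (a, b) \<in> {(X2, X1), (Y2, Y1)} \<union> XY" for a b :: letter
    by (cases a; cases b) (simp_all add: less_letter_def)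
  then show ?thesis by auto
qed

text \<open>Two descents at different places share a letter or are disjoint; these are the two kinds
  of ambiguity in the diamond lemma.\<close>

lemma two_descents_cases:
  assumes "u @ [a, b] @ v = u' @ [a', b'] @ v'" "length u < length u'"
  obtains (overlap) "u' = u @ [a]" "b = a'" "v = b' # v'"
  | (disjoint) m where "u' = u @ [a, b] @ m" "v = m @ [a', b'] @ v'"
proof -
  obtain us where us: "u' = u @ us" "[a, b] @ v = us @ [a', b'] @ v'"
    using assms by (auto simp: append_eq_append_conv2)
  then have "us \<noteq> []" using assms(2) by auto
  then show thesis
    using us overlap disjoint by (auto simp: Cons_eq_append_conv append_eq_Cons_conv)
qed

section \<open>Two-sided ideals and cosets\<close>

lemma ideal_free_algebraI:
  assumes "0 \<in> J" "\<And>f g. f \<in> J \<Longrightarrow> g \<in> J \<Longrightarrow> f - g \<in> J"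
    and "\<And>f g. f \<in> J \<Longrightarrow> g * f \<in> J" "\<And>f g. f \<in> J \<Longrightarrow> f * g \<in> J"
  shows "ideal J (free_algebra :: ('k::field, 'k falg) module)"
proof (rule idealI)
  interpret ring "free_algebra :: ('k, 'k falg) module" by (rule ring_free_algebra)
  show "ring (free_algebra :: ('k, 'k falg) module)" by (rule ring_free_algebra)
  have minus: "\<ominus>\<^bsub>free_algebra\<^esub> f = - f" for f :: "'k falg"
    by (rule minus_equality) (simp_all add: free_algebra_def)
  have neg: "- f \<in> J" if "f \<in> J" for f
    using assms(2)[OF assms(1) that] by simp
  show "subgroup J (add_monoid (free_algebra :: ('k, 'k falg) module))"
  proof
    show "x \<otimes>\<^bsub>add_monoid free_algebra\<^esub> y \<in> J" if "x \<in> J" "y \<in> J" for x y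
      using assms(2)[OF that(1) neg[OF that(2)]] by (simp add: free_algebra_def)
    show "inv\<^bsub>add_monoid free_algebra\<^esub> x \<in> J" if "x \<in> J" for x
      using neg[OF that] minus[of x] by (simp add: a_inv_def)
  qed (use assms(1) in \<open>auto simp: free_algebra_def\<close>)
qed (use assms in \<open>auto simp: free_algebra_def\<close>)

lemma gen_ideal_superset: "S \<subseteq> gen_ideal S"
  unfolding gen_ideal_def
  by (rule ring.genideal_self[OF ring_free_algebra]) (simp add: free_algebra_def)

lemma gen_ideal_minimal:
  "ideal J (free_algebra :: ('k::field, 'k falg) module) \<Longrightarrow> S \<subseteq> J \<Longrightarrow> gen_ideal S \<subseteq> J"
  unfolding gen_ideal_def by (rule ring.genideal_minimal[OF ring_free_algebra])

lemma
  fixes S :: "'k::field falg set"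
  shows gen_ideal_zero: "0 \<in> gen_ideal S"
    and gen_ideal_add: "f \<in> gen_ideal S \<Longrightarrow> g \<in> gen_ideal S \<Longrightarrow> f + g \<in> gen_ideal S"
    and gen_ideal_mult_left: "f \<in> gen_ideal S \<Longrightarrow> h * f \<in> gen_ideal S"
    and gen_ideal_mult_right: "f \<in> gen_ideal S \<Longrightarrow> f * h \<in> gen_ideal S"
    and gen_ideal_scale: "f \<in> gen_ideal S \<Longrightarrow> c \<cdot> f \<in> gen_ideal S"
    and gen_ideal_minus: "f \<in> gen_ideal S \<Longrightarrow> - f \<in> gen_ideal S"
proof -
  interpret ideal "gen_ideal S" "free_algebra :: ('k, 'k falg) module" by (rule ideal_gen_ideal)
  show "0 \<in> gen_ideal S"
    using additive_subgroup.zero_closed[OF is_additive_subgroup] by (simp add: free_algebra_def)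
  show "f + g \<in> gen_ideal S" if "f \<in> gen_ideal S" "g \<in> gen_ideal S"
    using additive_subgroup.a_closed[OF is_additive_subgroup that] by (simp add: free_algebra_def)
  show mult: "h * f \<in> gen_ideal S" if "f \<in> gen_ideal S" for f h
    using I_l_closed[OF that, of h] by (simp add: free_algebra_def)
  show "f * h \<in> gen_ideal S" if "f \<in> gen_ideal S"
    using I_r_closed[OF that, of h] by (simp add: free_algebra_def)
  show "c \<cdot> f \<in> gen_ideal S" if "f \<in> gen_ideal S"
    using mult[OF that] by (simp add: scale_eq)
  show "- f \<in> gen_ideal S" if "f \<in> gen_ideal S"
    using mult[OF that, of "- 1"] by simp
qed

lemma flinear_closed:
  assumes "flinear \<phi>" "0 \<in> J" "\<And>f g. f \<in> J \<Longrightarrow> g \<in> J \<Longrightarrow> f + g \<in> J" "\<And>c f. f \<in> J \<Longrightarrow> c \<cdot> f \<in> J"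
    and "\<And>w. w \<in> Poly_Mapping.keys f \<Longrightarrow> \<phi> (word w) \<in> J"
  shows "\<phi> f \<in> J"
proof -
  have "(\<Sum>w\<in>W. Poly_Mapping.lookup f w \<cdot> \<phi> (word w)) \<in> J" if "W \<subseteq> Poly_Mapping.keys f" for W
    using finite_subset[OF that finite_keys] that by (induction W rule: finite_induct) (auto simp: assms)
  moreover have "\<phi> f = (\<Sum>w\<in>Poly_Mapping.keys f. Poly_Mapping.lookup f w \<cdot> \<phi> (word w))"
    by (subst extend_word_id[of f, symmetric], unfold extend_def)
      (simp add: flinear_sum flinear_scale assms(1))
  ultimately show ?thesis by simp
qed

lemma proj_eq_iff: "proj S f = proj S g \<longleftrightarrow> f - g \<in> gen_ideal S"
proof -
  interpret ideal "gen_ideal S" "free_algebra" by (rule ideal_gen_ideal)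
  have self: "h \<in> proj S h" for h
    using a_rcos_self[of h] by (simp add: proj_def free_algebra_def)
  have mem: "h \<in> proj S k \<longleftrightarrow> h - k \<in> gen_ideal S" for h k
    by (force simp: proj_def a_r_coset_def' free_algebra_def)
  have "f - g \<in> gen_ideal S \<Longrightarrow> proj S f = proj S g"
    using a_repr_independence'[of f g] mem[of f g] by (simp add: proj_def free_algebra_def)
  then show ?thesis using self[of f] mem[of f g] by auto
qed

lemma gen_ideal_subset: "S \<subseteq> gen_ideal T \<Longrightarrow> gen_ideal S \<subseteq> gen_ideal T"
  by (intro gen_ideal_minimal ideal_gen_ideal)

text \<open>Injectivity is needed because a linear combination in the quotient runs over cosets, so that
  two words with the same coset would be counted once.\<close>

lemma lincomb_proj:
  fixes S :: "'k::field falg set"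
  assumes "finite W" "inj_on (\<lambda>w. proj S (word w)) W"
  shows "module.lincomb (presented_algebra S) a ((\<lambda>w. proj S (word w)) ` W) =
    proj S (\<Sum>w\<in>W. a (proj S (word w)) \<cdot> word w)"
proof -
  interpret vectorspace "class_ring :: 'k ring" "presented_algebra S"
    by (rule vectorspace_presented_algebra)
  show ?thesis
    using assms
  proof (induction W rule: finite_induct)
    case empty
    then show ?case by (simp add: lincomb_def presented_algebra_simps)
  next
    case (insert w W)
    have "proj S (word w) \<notin> (\<lambda>w. proj S (word w)) ` W"
      using insert by auto
    then have "lincomb a ((\<lambda>w. proj S (word w)) ` insert w W)
        = a (proj S (word w)) \<odot>\<^bsub>presented_algebra S\<^esub> proj S (word w) \<oplus>\<^bsub>presented_algebra S\<^esub>
          lincomb a ((\<lambda>w. proj S (word w)) ` W)"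
      unfolding lincomb_def image_insert using insert.hyps(1)
      by (intro finsum_insert) (auto simp: presented_algebra_simps(1) proj_scale)
    then show ?case
      using insert by (simp add: proj_scale presented_algebra_simps)
  qed
qed

section \<open>The normal form of a confluent quadratic rewriting system\<close>

lemma word_mult: "word u * word v = word (u @ v)"
  by (simp add: word_append)

lemma word_Cons: "word (a # v) = word [a] * word v"
  by (simp add: word_mult)

lemma keys_sandwich:
  "Poly_Mapping.keys (word u * f * word v) \<subseteq> (\<lambda>t. u @ t @ v) ` Poly_Mapping.keys f"
  using keys_mult[of "word u * f" "word v"] keys_mult[of "word u" f]
  by (fastforce simp: plus_list_def)

definition descent_relations :: "(letter \<Rightarrow> letter \<Rightarrow> 'k::field falg) \<Rightarrow> 'k falg set" where
  "descent_relations r = {word [a, b] - r a b | a b. b < a}"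

text \<open>The rule \<open>ab \<rightarrow> r a b\<close> applies to each descent.  Confluence of the overlap \<open>cba\<close> asks that
  \<open>r c b \<cdot> a\<close> and \<open>c \<cdot> r b a\<close> agree modulo the span of all \<open>p(de - r d e)q\<close> whose leading word is
  smaller than \<open>cba\<close>.  This is stated dually: every linear map that kills those elements takes the
  same value on both sides.  In the proof of the diamond lemma the maps needed are
  \<open>f \<mapsto> nf (u f v)\<close>, so the condition can be used inside any context \<open>u _ v\<close>.\<close>

locale quadratic_rewriting =
  fixes r :: "letter \<Rightarrow> letter \<Rightarrow> 'k::field falg"
  assumes keys_r: "b < a \<Longrightarrow> w \<in> Poly_Mapping.keys (r a b) \<Longrightarrow> length w = 2 \<and> sorted w \<and> w < [a, b]"
    and confluent: "\<And>c b a \<phi>. b < c \<Longrightarrow> a < b \<Longrightarrow> flinear \<phi> \<Longrightarrow>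
      (\<And>p d e q. e < d \<Longrightarrow> length p + length q = 1 \<Longrightarrow> p @ [d, e] @ q < [c, b, a] \<Longrightarrow>
        \<phi> (word (p @ [d, e] @ q)) = \<phi> (word p * r d e * word q)) \<Longrightarrow>
      \<phi> (r c b * word [a]) = \<phi> (word [c] * r b a)"
begin

abbreviation "relations \<equiv> descent_relations r"

text \<open>Which descent is chosen does not matter in the end, by \<open>nf_rewrite\<close> below; choosing one makes the
  normal form a function from the outset.\<close>

definition reduce :: "letter list \<Rightarrow> 'k falg" where
  "reduce w = (SOME f. \<exists>u a b v. w = u @ [a, b] @ v \<and> b < a \<and> f = word u * r a b * word v)"

lemma reduce:
  assumes "\<not> sorted w"
  obtains u a b v where "w = u @ [a, b] @ v" "b < a" "reduce w = word u * r a b * word v"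
proof -
  have "\<exists>f u a b v. w = u @ [a, b] @ v \<and> b < a \<and> f = word u * r a b * word v"
    using assms by (auto simp: sorted_iff_no_descent)
  from someI_ex[OF this] that show thesis
    unfolding reduce_def by blast
qed

lemma keys_sandwich_less:
  assumes "b < a" "t \<in> Poly_Mapping.keys (word u * r a b * word v)"
  shows "t < u @ [a, b] @ v"
  using assms keys_sandwich[of u "r a b" v] keys_r[OF assms(1)]
  by (auto intro!: append_less_append[of _ "[a, b]", simplified])

lemma keys_reduce: "\<not> sorted w \<Longrightarrow> t \<in> Poly_Mapping.keys (reduce w) \<Longrightarrow> t < w"
  by (metis reduce keys_sandwich_less)

function nf_word :: "letter list \<Rightarrow> 'k falg" where
  "nf_word w = (if sorted w then word w else extend nf_word (reduce w))"
  by auto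
termination
  by (relation "{(v, w). v < w}") (auto simp: wf keys_reduce)

declare nf_word.simps [simp del]

definition nf :: "'k falg \<Rightarrow> 'k falg" where
  "nf = extend nf_word"

lemma flinear_nf: "flinear nf"
  by (simp add: nf_def flinear_extend)

lemma nf_sorted: "sorted w \<Longrightarrow> nf (word w) = word w"
  by (simp add: nf_def nf_word.simps)

lemma nf_not_sorted: "\<not> sorted w \<Longrightarrow> nf (word w) = nf (reduce w)"
  by (simp add: nf_def nf_word.simps[of w])

text \<open>The diamond lemma: the normal form does not depend on which descent is rewritten first.  By
  induction on the word.  For two disjoint descents, both results lead to the word in
  which both have been rewritten, by the induction hypothesis for the smaller words that occur.
  For overlapping descents, confluence applies to \<open>f \<mapsto> nf (u f v)\<close>, which respects all rewritings
  below \<open>u cba v\<close> by the induction hypothesis.\<close>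

lemma nf_rewrite:
  assumes "b < a"
  shows "nf (word (u @ [a, b] @ v)) = nf (word u * r a b * word v)"
proof -
  have "\<forall>u a b v. w = u @ [a, b] @ v \<longrightarrow> b < a \<longrightarrow> nf (word w) = nf (word u * r a b * word v)" for w
  proof (induction w rule: less_induct)
    case (less w)
    have IH: "nf (word (u @ [a, b] @ v)) = nf (word u * r a b * word v)"
      if "u @ [a, b] @ v < w" "b < a" for u a b v
      using less.IH that by blast
    have agree: "nf (word u * r a b * word v) = nf (word u' * r a' b' * word v')"
      if w: "w = u @ [a, b] @ v" "w = u' @ [a', b'] @ v'" and d: "b < a" "b' < a'"
        and l: "length u < length u'" for u a b v u' a' b' v'
    proof -
      have "u @ [a, b] @ v = u' @ [a', b'] @ v'" using w by simp
      from this l show ?thesis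
      proof (cases rule: two_descents_cases)
        case overlap
        have w': "w = u @ [a, b, b'] @ v'" using w(1) overlap by simp
        have "nf (word u * (r a b * word [b']) * word v') = nf (word u * (word [a] * r b b') * word v')"
        proof (rule confluent)
          show "b < a" "b' < b" using d overlap by auto
          show "flinear (\<lambda>f. nf (word u * f * word v'))"
            by (rule flinear_sandwich[OF flinear_nf])
          fix p d e q
          assume *: "e < (d :: letter)" "length p + length q = 1" "p @ [d, e] @ q < [a, b, b']"
          have "u @ (p @ [d, e] @ q) @ v' < w"
            unfolding w' by (rule append_less_append) (use * in auto)
          then show "nf (word u * word (p @ [d, e] @ q) * word v') = nf (word u * (word p * r d e * word q) * word v')"
            using IH[of "u @ p" d e "q @ v'"] * by (simp only: word_append mult.assoc append_assoc)
        qed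
        then show ?thesis
          by (simp add: overlap word_append[of u] word_Cons[of b' v'] mult.assoc)
      next
        case (disjoint m)
        have "nf (word u * r a b * word v) = nf (word u * r a b * (word m * word [a', b'] * word v'))"
          by (simp only: disjoint word_append mult.assoc)
        also have "\<dots> = nf (word u * r a b * (word m * r a' b' * word v'))"
        proof (rule flinear_eq_on_keys[where \<phi> = "\<lambda>f. nf (word u * f * (word m * word [a', b'] * word v'))"
              and \<psi> = "\<lambda>f. nf (word u * f * (word m * r a' b' * word v'))"])
          fix t assume t: "t \<in> Poly_Mapping.keys (r a b)"
          have "u @ t @ v < w"
            unfolding w(1) by (rule append_less_append) (use keys_r[OF d(1) t] in auto)
          then show "nf (word u * word t * (word m * word [a', b'] * word v'))
              = nf (word u * word t * (word m * r a' b' * word v'))"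
            using IH[of "u @ t @ m" a' b' v'] d
            by (simp only: disjoint word_append mult.assoc append_assoc)
        qed (rule flinear_sandwich[OF flinear_nf])+
        also have "\<dots> = nf ((word u * r a b * word m) * r a' b' * word v')"
          by (simp only: mult.assoc)
        also have "\<dots> = nf ((word u * word [a, b] * word m) * r a' b' * word v')"
        proof (rule flinear_eq_on_keys[where \<phi> = "\<lambda>f. nf ((word u * r a b * word m) * f * word v')"
              and \<psi> = "\<lambda>f. nf ((word u * word [a, b] * word m) * f * word v')"])
          fix t assume t: "t \<in> Poly_Mapping.keys (r a' b')"
          have "u' @ t @ v' < w"
            unfolding w(2) by (rule append_less_append) (use keys_r[OF d(2) t] in auto)
          then show "nf ((word u * r a b * word m) * word t * word v')
              = nf ((word u * word [a, b] * word m) * word t * word v')"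
            using IH[of u a b "m @ t @ v'"] d
            by (simp only: disjoint word_append mult.assoc append_assoc)
        qed (rule flinear_sandwich[OF flinear_nf])+
        also have "\<dots> = nf (word u' * r a' b' * word v')"
          by (simp only: disjoint word_append mult.assoc)
        finally show ?thesis .
      qed
    qed
    show ?case
    proof (intro allI impI)
      fix u a b v assume w: "w = u @ [a, b] @ v" and d: "b < a"
      then have "\<not> sorted w" by (auto simp: sorted_iff_no_descent)
      then obtain u' a' b' v' where w': "w = u' @ [a', b'] @ v'" and d': "b' < a'"
        and red: "reduce w = word u' * r a' b' * word v'"
        by (rule reduce)
      have "nf (word u * r a b * word v) = nf (word u' * r a' b' * word v')"
      proof (cases "length u" "length u'" rule: linorder_cases)
        case less
        then show ?thesis using agree w w' d d' by blast
      next
        case greater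
        then show ?thesis using agree[OF w' w] d d' by simp
      next
        case equal
        then show ?thesis using w w' by simp
      qed
      then show "nf (word w) = nf (word u * r a b * word v)"
        using nf_not_sorted[OF \<open>\<not> sorted w\<close>] red by simp
    qed
  qed
  then show ?thesis using assms by blast
qed

text \<open>The elements that \<open>nf\<close> kills in every context form an ideal, and it contains the relations
  by \<open>nf_rewrite\<close>.\<close>

lemma nf_gen_ideal:
  assumes "f \<in> gen_ideal relations"
  shows "nf f = 0"
proof -
  define J where "J = {f. \<forall>u v. nf (word u * f * word v) = 0}"
  have "ideal J free_algebra"
  proof (rule ideal_free_algebraI)
    show "0 \<in> J" by (simp add: J_def flinear_zero flinear_nf)
    show "f - g \<in> J" if "f \<in> J" "g \<in> J" for f g
      using that by (simp add: J_def algebra_simps flinear_diff flinear_nf)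
    fix f g assume f: "f \<in> J"
    have "nf (word u * g * (f * word v)) = 0" for u v
      using flinear_closed[OF flinear_sandwich[OF flinear_nf], of "{0}" g "word u" "f * word v"] f
      by (simp add: J_def word_mult flip: mult.assoc)
    then show "g * f \<in> J" by (simp add: J_def mult.assoc)
    have "nf ((word u * f) * g * word v) = 0" for u v
      using flinear_closed[OF flinear_sandwich[OF flinear_nf], of "{0}" g "word u * f" "word v"] f
      by (simp add: J_def word_mult mult.assoc)
    then show "f * g \<in> J" by (simp add: J_def mult.assoc)
  qed
  moreover have "relations \<subseteq> J"
    using nf_rewrite
    by (auto simp: J_def descent_relations_def right_diff_distrib left_diff_distrib flinear_diff[OF flinear_nf] word_mult)
  ultimately have "f \<in> J" using gen_ideal_minimal assms by blast
  then have "nf (word [] * f * word []) = 0" unfolding J_def by blast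
  then show ?thesis by (simp add: word_Nil)
qed

lemma word_minus_reduce:
  assumes "\<not> sorted w"
  shows "word w - reduce w \<in> gen_ideal relations"
proof -
  obtain u a b v where w: "w = u @ [a, b] @ v" "b < a" "reduce w = word u * r a b * word v"
    using reduce[OF assms] .
  have "word [a, b] - r a b \<in> gen_ideal relations"
    using gen_ideal_superset[of relations] w(2) unfolding descent_relations_def by blast
  then have "word u * (word [a, b] - r a b) * word v \<in> gen_ideal relations"
    by (intro gen_ideal_mult_left gen_ideal_mult_right)
  then show ?thesis
    unfolding w(3) by (simp only: w(1) word_append right_diff_distrib left_diff_distrib mult.assoc)
qed

lemma minus_nf: "f - nf f \<in> gen_ideal relations"
proof -
  have word: "word w - nf (word w) \<in> gen_ideal relations" for w
  proof (induction w rule: less_induct)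
    case (less w)
    show ?case
    proof (cases "sorted w")
      case False
      have "reduce w - nf (reduce w) \<in> gen_ideal relations"
        by (rule flinear_closed[where \<phi> = "\<lambda>f. f - nf f"])
          (auto intro!: flinearI less.IH gen_ideal_zero gen_ideal_add gen_ideal_scale keys_reduce False
            simp: flinear_add[OF flinear_nf] flinear_scale[OF flinear_nf] falg.scale_right_diff_distrib)
      from gen_ideal_add[OF word_minus_reduce[OF False] this] show ?thesis
        by (simp add: nf_not_sorted[OF False])
    qed (simp add: nf_sorted gen_ideal_zero)
  qed
  show ?thesis
    by (rule flinear_closed[where \<phi> = "\<lambda>f. f - nf f"])
      (auto intro!: flinearI word gen_ideal_zero gen_ideal_add gen_ideal_scale
        simp: flinear_add[OF flinear_nf] flinear_scale[OF flinear_nf] falg.scale_right_diff_distrib)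
qed

lemma sorted_keys_nf:
  assumes "w \<in> Poly_Mapping.keys (nf f)"
  shows "sorted w"
proof -
  define J where "J = {f :: 'k falg. \<forall>w\<in>Poly_Mapping.keys f. sorted w}"
  have J: "0 \<in> J" "f + g \<in> J" "c \<cdot> f \<in> J" if "f \<in> J" "g \<in> J" for f g c
    using that keys_add[of f g] by (auto simp: J_def in_keys_iff lookup_scale lookup_add)
  have "0 \<in> J" by (simp add: J_def)
  have word: "nf (word w) \<in> J" for w
  proof (induction w rule: less_induct)
    case (less w)
    show ?case
    proof (cases "sorted w")
      case False
      have "nf (reduce w) \<in> J"
        by (rule flinear_closed[OF flinear_nf]) (auto intro!: less.IH J keys_reduce False \<open>0 \<in> J\<close>)
      then show ?thesis by (simp add: nf_not_sorted[OF False])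
    qed (simp add: nf_sorted J_def)
  qed
  have "nf f \<in> J"
    by (rule flinear_closed[OF flinear_nf]) (auto intro!: J word \<open>0 \<in> J\<close>)
  then show ?thesis using assms by (simp add: J_def)
qed

text \<open>As \<open>r a b\<close> involves only words smaller than \<open>ab\<close>, nothing can cancel the word \<open>ab\<close>.\<close>

lemma leading_relation:
  assumes "b < a"
  shows "leading_word (word [a, b] - r a b) = [a, b]" "monic (word [a, b] - r a b)"
proof -
  let ?s = "word [a, b] - r a b"
  have r: "Poly_Mapping.lookup (r a b) [a, b] = 0"
    using keys_r[OF assms, of "[a, b]"] by (auto simp: in_keys_iff)
  then have l: "Poly_Mapping.lookup ?s [a, b] = 1"
    by (simp add: lookup_minus lookup_word)
  have "t \<le> [a, b]" if "t \<in> Poly_Mapping.keys ?s" for t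
    using that keys_r[OF assms, of t]
    by (cases "t \<in> Poly_Mapping.keys (r a b)")
      (auto simp: in_keys_iff lookup_minus lookup_word when_def split: if_splits)
  then show lead: "leading_word ?s = [a, b]"
    unfolding leading_word_def by (intro Max_eqI) (auto simp: in_keys_iff l)
  show "monic ?s"
    unfolding monic_def lead using l by auto
qed

lemma card_relations: "card relations = 6"
proof -
  let ?D = "{(a, b :: letter). b < a}"
  have "card ?D = 6" by (simp add: descents)
  moreover have "relations = (\<lambda>(a, b). word [a, b] - r a b) ` ?D"
    by (auto simp: descent_relations_def)
  moreover have "inj_on (\<lambda>(a, b). word [a, b] - r a b) ?D"
    by (rule inj_onI) (auto dest: arg_cong[of _ _ leading_word] simp: leading_relation)
  ultimately show ?thesis by (simp add: card_image)
qed

lemma Irr_relations: "Irr relations = {w. sorted w}"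
proof (rule Set.set_eqI)
  fix w
  have "w \<in> Irr relations \<longleftrightarrow>
      (\<forall>a b. b < a \<longrightarrow> (\<forall>u v. w \<noteq> u @ leading_word (word [a, b] - r a b) @ v))"
    unfolding Irr_def descent_relations_def by blast
  also have "\<dots> \<longleftrightarrow> (\<forall>a b. b < a \<longrightarrow> (\<forall>u v. w \<noteq> u @ [a, b] @ v))"
    by (simp add: leading_relation)
  also have "\<dots> \<longleftrightarrow> w \<in> Collect sorted"
    unfolding sorted_iff_no_descent mem_Collect_eq by blast
  finally show "w \<in> Irr relations \<longleftrightarrow> w \<in> Collect sorted" .
qed

lemma inj_on_sorted: "inj_on (\<lambda>w. proj relations (word w)) {w. sorted w}"
proof (rule inj_onI)
  fix v w :: "letter list" assume *: "v \<in> {w. sorted w}" "w \<in> {w. sorted w}"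
    "proj relations (word v) = proj relations (word w)"
  then have "nf (word v - word w) = 0" by (simp add: proj_eq_iff nf_gen_ideal)
  then have "(word v :: 'k falg) = word w"
    using * by (simp add: flinear_diff[OF flinear_nf] nf_sorted)
  then have "Poly_Mapping.keys (word v :: 'k falg) = Poly_Mapping.keys (word w :: 'k falg)" by simp
  then show "v = w" by simp
qed

text \<open>A combination of sorted words is its own normal form, hence zero if it lies in the ideal;
  and every coset contains the normal form of its elements.\<close>

lemma basis_sorted:
  "vectorspace.basis (class_ring :: 'k ring) (presented_algebra relations)
    ((\<lambda>w. proj relations (word w)) ` {w. sorted w})"
proof -
  interpret vectorspace "class_ring :: 'k ring" "presented_algebra relations"
    by (rule vectorspace_presented_algebra)
  let ?p = "\<lambda>w. proj relations (word w)"
  have inj: "inj_on ?p W" if "W \<subseteq> {w. sorted w}" for W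
    using inj_on_sorted that by (rule inj_on_subset)
  have "\<not> lin_dep (?p ` {w. sorted w})"
  proof
    assume "lin_dep (?p ` {w. sorted w})"
    then obtain A a v where A: "finite A" "A \<subseteq> ?p ` {w. sorted w}" "lincomb a A = proj relations 0"
      "v \<in> A" "a v \<noteq> 0"
      by (auto simp: lin_dep_def presented_algebra_simps)
    then obtain W where W: "W \<subseteq> {w. sorted w}" "finite W" "A = ?p ` W"
      by (meson finite_subset_image)
    let ?f = "\<Sum>w\<in>W. a (?p w) \<cdot> word w"
    have "proj relations ?f = proj relations 0"
      using lincomb_proj[OF W(2) inj[OF W(1)]] A(3) W(3) by simp
    then have "nf ?f = 0" by (simp add: proj_eq_iff nf_gen_ideal)
    moreover have "nf ?f = ?f"
      by (simp add: flinear_sum[OF flinear_nf] flinear_scale[OF flinear_nf])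
        (intro sum.cong refl, use W(1) nf_sorted in auto)
    ultimately have "?f = 0" by simp
    obtain w where "w \<in> W" "v = ?p w" using A(4) W(3) by auto
    have "Poly_Mapping.lookup ?f w = a (?p w)"
      using W(2) \<open>w \<in> W\<close> by (simp add: lookup_sum lookup_scale lookup_word when_def
          if_distrib[of "\<lambda>x. _ * x"] cong: if_cong)
    then show False using \<open>?f = 0\<close> A(5) \<open>v = ?p w\<close> by simp
  qed
  moreover have "carrier (presented_algebra relations) \<subseteq> span (?p ` {w. sorted w})"
  proof
    fix x assume "x \<in> carrier (presented_algebra relations)"
    then obtain f where f: "x = proj relations f" by (auto simp: presented_algebra_simps)
    define W where "W = Poly_Mapping.keys (nf f)"
    have W: "finite W" "W \<subseteq> {w. sorted w}" by (auto simp: W_def sorted_keys_nf)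
    define a where "a = (\<lambda>x. Poly_Mapping.lookup (nf f) (inv_into W ?p x))"
    have "x = proj relations (nf f)" by (simp add: f proj_eq_iff minus_nf)
    also have "nf f = (\<Sum>w\<in>W. Poly_Mapping.lookup (nf f) w \<cdot> word w)"
      using extend_word_id[of "nf f"] by (simp add: extend_def W_def)
    also have "\<dots> = (\<Sum>w\<in>W. a (?p w) \<cdot> word w)"
      by (rule sum.cong) (simp_all add: a_def inv_into_f_f[OF inj[OF W(2)]])
    also have "proj relations \<dots> = lincomb a (?p ` W)"
      by (rule lincomb_proj[OF W(1) inj[OF W(2)], symmetric])
    finally have "x = lincomb a (?p ` W)" .
    moreover have "finite (?p ` W)" "?p ` W \<subseteq> ?p ` {w. sorted w}"
      using W by auto
    ultimately show "x \<in> span (?p ` {w. sorted w})"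
      unfolding span_def by (intro CollectI exI[of _ a] exI[of _ "?p ` W"]) simp
  qed
  moreover have "span (?p ` {w. sorted w}) \<subseteq> carrier (presented_algebra relations)"
    by (rule span_is_subset2) (auto simp: presented_algebra_simps(1))
  ultimately show ?thesis
    by (auto simp: basis_def presented_algebra_simps(1))
qed

end

section \<open>Standard monomials\<close>

lemma proj_power: "proj S f [^]\<^bsub>presented_algebra S\<^esub> (n::nat) = proj S (f ^ n)"
  by (induction n) (simp_all add: presented_algebra_simps power_Suc2 del: power_Suc)

lemma word_replicate: "word (replicate n a) = word [a] ^ n"
  by (induction n) (simp_all add: word_Nil word_Cons[of a "replicate _ a"])

lemma standard_monomial_letters:
  "standard_monomial (presented_algebra S) (map (proj S) [y\<^sub>1, y\<^sub>2, x\<^sub>1, x\<^sub>2]) [i, j, k, l] =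
    proj S (word (replicate i Y1 @ replicate j Y2 @ replicate k X1 @ replicate l X2))"
  by (simp add: standard_monomial_def proj_power presented_algebra_simps word_append word_replicate)

text \<open>Counting each letter in a sorted word recovers its exponents, so the standard monomials are
  the sorted words without repetition.\<close>

lemma PBW_basisI:
  fixes S :: "'k::field falg set"
  assumes "inj_on (\<lambda>w. proj S (word w)) {w. sorted w}"
    and "vectorspace.basis (class_ring :: 'k ring) (presented_algebra S)
      ((\<lambda>w. proj S (word w)) ` {w. sorted w})"
  shows "PBW_basis (presented_algebra S) (map (proj S) [y\<^sub>1, y\<^sub>2, x\<^sub>1, x\<^sub>2])
    ((\<lambda>w. proj S (word w)) ` {w. sorted w})"
proof -
  define E where "E = (\<lambda>as. replicate (as ! 0) Y1 @ replicate (as ! 1) Y2 @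
    replicate (as ! 2) X1 @ replicate (as ! 3) X2)"
  let ?L = "{as :: nat list. length as = 4}"
  have L: "\<exists>i j k l. as = [i, j, k, l]" if "as \<in> ?L" for as
    using that by (auto simp: length_Suc_conv eval_nat_numeral)
  have std: "standard_monomial (presented_algebra S) (map (proj S) [y\<^sub>1, y\<^sub>2, x\<^sub>1, x\<^sub>2]) as
      = proj S (word (E as))" if "as \<in> ?L" for as
    using L[OF that] by (auto simp: E_def standard_monomial_letters simp del: list.map)
  have sorted: "E ` ?L = {w. sorted w}"
  proof
    show "{w. sorted w} \<subseteq> E ` ?L"
    proof
      fix w :: "letter list" assume "w \<in> {w. sorted w}"
      then obtain i j k l where "w = E [i, j, k, l]"
        by (auto simp: sorted_letter_iff E_def)
      then show "w \<in> E ` ?L" by auto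
    qed
  qed (auto simp: sorted_letter_iff E_def)
  have "inj_on E ?L"
  proof (rule inj_onI)
    fix as bs assume *: "as \<in> ?L" "bs \<in> ?L" "E as = E bs"
    have "length (filter ((=) Y1) (E as)) = as ! 0" "length (filter ((=) Y2) (E as)) = as ! 1"
      "length (filter ((=) X1) (E as)) = as ! 2" "length (filter ((=) X2) (E as)) = as ! 3" for as
      by (simp_all add: E_def)
    then have "as ! 0 = bs ! 0" "as ! 1 = bs ! 1" "as ! 2 = bs ! 2" "as ! 3 = bs ! 3"
      using *(3) by metis+
    then show "as = bs" using L[OF *(1)] L[OF *(2)] by auto
  qed
  with assms(1) have "inj_on (\<lambda>as. proj S (word (E as))) ?L"
    using comp_inj_on[of E ?L "\<lambda>w. proj S (word w)"] by (simp add: sorted comp_def)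
  then have "inj_on (standard_monomial (presented_algebra S) (map (proj S) [y\<^sub>1, y\<^sub>2, x\<^sub>1, x\<^sub>2])) ?L"
    by (simp add: inj_on_def std del: list.map)
  moreover have "(\<lambda>w. proj S (word w)) ` {w. sorted w} =
      standard_monomial (presented_algebra S) (map (proj S) [y\<^sub>1, y\<^sub>2, x\<^sub>1, x\<^sub>2]) ` ?L"
    unfolding sorted[symmetric] image_image by (rule image_cong[OF refl std[symmetric]])
  moreover have "length (map (proj S) [y\<^sub>1, y\<^sub>2, x\<^sub>1, x\<^sub>2]) = 4"
    by simp
  ultimately show ?thesis
    unfolding PBW_basis_def using assms(2) by (simp only: simp_thms)
qed

section \<open>Two quadratic algebras glued by an exchange matrix\<close>

definition pair_word :: "letter \<times> letter \<Rightarrow> 'k::field falg" where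
  "pair_word i = word [fst i, snd i]"

text \<open>The \<open>x\<close>s and the \<open>y\<close>s are sorted among themselves by \<open>q\<close> and \<open>p\<^sub>1, p\<^sub>2\<close>; a pair \<open>xy\<close> is
  straightened by row \<open>(x, y)\<close> of the matrix \<open>m\<close>.\<close>

definition reduct ::
    "'k::field \<Rightarrow> 'k \<Rightarrow> 'k \<Rightarrow> (letter \<times> letter \<Rightarrow> letter \<times> letter \<Rightarrow> 'k) \<Rightarrow>
      letter \<Rightarrow> letter \<Rightarrow> 'k falg" where
  "reduct q p\<^sub>1 p\<^sub>2 m a b =
    (if a = X2 \<and> b = X1 then q \<cdot> word [X1, X2]
     else if a = Y2 \<and> b = Y1 then p\<^sub>1 \<cdot> word [Y1, Y2] + p\<^sub>2 \<cdot> word [Y1, Y1]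
     else (\<Sum>i\<in>YX. m (a, b) i \<cdot> pair_word i))"

text \<open>The coefficient of \<open>s t t'\<close> after first \<open>x\<close> and then \<open>x'\<close> have been moved past \<open>y\<close> in the
  word \<open>x' x y\<close>; the intermediate letter \<open>k\<close> is what \<open>x\<close> leaves of \<open>y\<close>.\<close>

definition xxy_coeff ::
    "(letter \<times> letter \<Rightarrow> letter \<times> letter \<Rightarrow> 'k::field) \<Rightarrow>
      letter \<Rightarrow> letter \<Rightarrow> letter \<Rightarrow> letter \<Rightarrow> letter \<Rightarrow> letter \<Rightarrow> 'k" where
  "xxy_coeff m x y x' t t' s = (\<Sum>k\<in>{Y1, Y2}. m (x, y) (k, t') * m (x', k) (s, t))"

text \<open>Likewise the coefficient of \<open>s s' t\<close> after \<open>x\<close> has been moved past \<open>y\<close> and then past \<open>y'\<close> in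
  the word \<open>x y y'\<close>.\<close>

definition xyy_coeff ::
    "(letter \<times> letter \<Rightarrow> letter \<times> letter \<Rightarrow> 'k::field) \<Rightarrow>
      letter \<Rightarrow> letter \<Rightarrow> letter \<Rightarrow> letter \<Rightarrow> letter \<Rightarrow> letter \<Rightarrow> 'k" where
  "xyy_coeff m x y y' s s' t = (\<Sum>l\<in>{X1, X2}. m (x, y) (s, l) * m (l, y') (s', t))"

text \<open>The identities say that moving \<open>x\<^sub>2x\<^sub>1 - q x\<^sub>1x\<^sub>2\<close> past a \<open>y\<close>, and \<open>y\<^sub>2y\<^sub>1 - p\<^sub>1y\<^sub>1y\<^sub>2 - p\<^sub>2y\<^sub>1\<^sup>2\<close>
  past an \<open>x\<close>, yields zero once the result is sorted again.  The three parts of \<open>x_relation\<close> compare the coefficients of \<open>s x\<^sub>1x\<^sub>1\<close>,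
  \<open>s x\<^sub>2x\<^sub>2\<close> and \<open>s x\<^sub>1x\<^sub>2\<close>, those of \<open>y_relation\<close> the coefficients of \<open>y\<^sub>1y\<^sub>1t\<close>, \<open>y\<^sub>1y\<^sub>2t\<close> and
  \<open>y\<^sub>2y\<^sub>2t\<close>; the extra summands come from sorting \<open>s x\<^sub>2x\<^sub>1\<close> and \<open>y\<^sub>2y\<^sub>1t\<close>.\<close>

locale twisted_product =
  fixes q p\<^sub>1 p\<^sub>2 :: "'k::field" and m :: "letter \<times> letter \<Rightarrow> letter \<times> letter \<Rightarrow> 'k"
  assumes x_relation: "y \<in> {Y1, Y2} \<Longrightarrow> s \<in> {Y1, Y2} \<Longrightarrow>
      xxy_coeff m X1 y X2 X1 X1 s = q * xxy_coeff m X2 y X1 X1 X1 s \<and>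
      xxy_coeff m X1 y X2 X2 X2 s = q * xxy_coeff m X2 y X1 X2 X2 s \<and>
      xxy_coeff m X1 y X2 X1 X2 s + q * xxy_coeff m X1 y X2 X2 X1 s =
        q * (xxy_coeff m X2 y X1 X1 X2 s + q * xxy_coeff m X2 y X1 X2 X1 s)"
    and y_relation: "x \<in> {X1, X2} \<Longrightarrow> t \<in> {X1, X2} \<Longrightarrow>
      xyy_coeff m x Y2 Y1 Y1 Y1 t + p\<^sub>2 * xyy_coeff m x Y2 Y1 Y2 Y1 t =
        p\<^sub>1 * (xyy_coeff m x Y1 Y2 Y1 Y1 t + p\<^sub>2 * xyy_coeff m x Y1 Y2 Y2 Y1 t) +
        p\<^sub>2 * (xyy_coeff m x Y1 Y1 Y1 Y1 t + p\<^sub>2 * xyy_coeff m x Y1 Y1 Y2 Y1 t) \<and>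
      xyy_coeff m x Y2 Y1 Y1 Y2 t + p\<^sub>1 * xyy_coeff m x Y2 Y1 Y2 Y1 t =
        p\<^sub>1 * (xyy_coeff m x Y1 Y2 Y1 Y2 t + p\<^sub>1 * xyy_coeff m x Y1 Y2 Y2 Y1 t) +
        p\<^sub>2 * (xyy_coeff m x Y1 Y1 Y1 Y2 t + p\<^sub>1 * xyy_coeff m x Y1 Y1 Y2 Y1 t) \<and>
      xyy_coeff m x Y2 Y1 Y2 Y2 t =
        p\<^sub>1 * xyy_coeff m x Y1 Y2 Y2 Y2 t + p\<^sub>2 * xyy_coeff m x Y1 Y1 Y2 Y2 t"
begin

abbreviation "rd \<equiv> reduct q p\<^sub>1 p\<^sub>2 m"

lemma keys_rd:
  assumes "b < a" "w \<in> Poly_Mapping.keys (rd a b)"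
  shows "length w = 2 \<and> sorted w \<and> w < [a, b]"
proof -
  have "(a, b) \<in> {(X2, X1), (Y2, Y1)} \<union> XY"
    using assms(1) by (cases a; cases b) (simp_all add: less_letter_def)
  then show ?thesis
    using assms(2)
    by (auto simp: reduct_def pair_word_def in_keys_iff lookup_add lookup_scale lookup_word when_def
        less_eq_letter_def less_letter_def Cons_less_Cons split: if_splits)
qed

text \<open>The overlap \<open>x\<^sub>2x\<^sub>1y\<close>: on both sides two moves past a \<open>y\<close> and one sorting step lead to a
  combination of the six words \<open>s x\<^sub>1x\<^sub>1\<close>, \<open>s x\<^sub>1x\<^sub>2\<close>, \<open>s x\<^sub>2x\<^sub>2\<close>, and \<open>x_relation\<close> equates the
  coefficients.\<close>

lemma exchange_xxy:
  assumes \<phi>: "flinear \<phi>" and y: "y \<in> {Y1, Y2}"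
    and swap: "\<And>x k l. x \<in> {X1, X2} \<Longrightarrow> k \<in> {Y1, Y2} \<Longrightarrow> l \<in> {X1, X2} \<Longrightarrow>
      \<phi> (word [x, k, l]) = \<phi> (rd x k * word [l])"
    and sort: "\<And>s. s \<in> {Y1, Y2} \<Longrightarrow> \<phi> (word [s, X2, X1]) = \<phi> (word [s] * rd X2 X1)"
    and mid: "\<phi> (word [X1, X2, y]) = \<phi> (word [X1] * rd X2 y)"
  shows "\<phi> (rd X2 X1 * word [y]) = \<phi> (word [X2] * rd X1 y)"
proof -
  note lin = flinear_add[OF \<phi>] flinear_scale[OF \<phi>] scale_mult_left scale_mult_right
    word_mult distrib_left distrib_right
  have sort': "\<phi> (word [s, X2, X1]) = q \<cdot> \<phi> (word [s, X1, X2])" if "s \<in> {Y1, Y2}" for s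
    using sort[OF that] by (simp add: reduct_def lin)
  have two_swaps: "\<phi> (word [x'] * rd x y) =
      (\<Sum>s\<in>{Y1, Y2}. xxy_coeff m x y x' X1 X1 s \<cdot> \<phi> (word [s, X1, X1]) +
        (xxy_coeff m x y x' X1 X2 s + q * xxy_coeff m x y x' X2 X1 s) \<cdot> \<phi> (word [s, X1, X2]) +
        xxy_coeff m x y x' X2 X2 s \<cdot> \<phi> (word [s, X2, X2]))"
    if "x \<in> {X1, X2}" "x' \<in> {X1, X2}" for x x'
  proof -
    have "rd x y = (\<Sum>i\<in>YX. m (x, y) i \<cdot> pair_word i)"
      "\<And>k. k \<in> {Y1, Y2} \<Longrightarrow> rd x' k = (\<Sum>i\<in>YX. m (x', k) i \<cdot> pair_word i)"
      using that y by (auto simp: reduct_def)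
    then show ?thesis
      using that
      by (intro poly_mapping_eqI)
        (simp add: pair_word_def xxy_coeff_def lin swap sort' lookup_add lookup_scale algebra_simps)
  qed
  have "\<phi> (rd X2 X1 * word [y]) = q \<cdot> \<phi> (word [X1] * rd X2 y)"
    by (simp add: reduct_def[of q p\<^sub>1 p\<^sub>2 m X2 X1] lin mid)
  also have "\<dots> = \<phi> (word [X2] * rd X1 y)"
    using x_relation[OF y, of Y1] x_relation[OF y, of Y2]
    by (simp add: two_swaps falg.scale_right_distrib)
  finally show ?thesis .
qed

lemma exchange_xyy:
  assumes \<phi>: "flinear \<phi>" and x: "x \<in> {X1, X2}"
    and swap: "\<And>k l j. k \<in> {Y1, Y2} \<Longrightarrow> l \<in> {X1, X2} \<Longrightarrow> j \<in> {Y1, Y2} \<Longrightarrow>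
      \<phi> (word [k, l, j]) = \<phi> (word [k] * rd l j)"
    and sort: "\<And>t. t \<in> {X1, X2} \<Longrightarrow> \<phi> (word [Y2, Y1, t]) = \<phi> (rd Y2 Y1 * word [t])"
    and mid: "\<And>j. j \<in> {Y1, Y2} \<Longrightarrow> \<phi> (word [x, Y1, j]) = \<phi> (rd x Y1 * word [j])"
  shows "\<phi> (rd x Y2 * word [Y1]) = \<phi> (word [x] * rd Y2 Y1)"
proof -
  note lin = flinear_add[OF \<phi>] flinear_scale[OF \<phi>] scale_mult_left scale_mult_right
    word_mult distrib_left distrib_right
  have sort': "\<phi> (word [Y2, Y1, t]) = p\<^sub>1 \<cdot> \<phi> (word [Y1, Y2, t]) + p\<^sub>2 \<cdot> \<phi> (word [Y1, Y1, t])"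
    if "t \<in> {X1, X2}" for t
    using sort[OF that] by (simp add: reduct_def lin)
  have two_swaps: "\<phi> (rd x y * word [y']) =
      (\<Sum>t\<in>{X1, X2}.
        (xyy_coeff m x y y' Y1 Y1 t + p\<^sub>2 * xyy_coeff m x y y' Y2 Y1 t) \<cdot> \<phi> (word [Y1, Y1, t]) +
        (xyy_coeff m x y y' Y1 Y2 t + p\<^sub>1 * xyy_coeff m x y y' Y2 Y1 t) \<cdot> \<phi> (word [Y1, Y2, t]) +
        xyy_coeff m x y y' Y2 Y2 t \<cdot> \<phi> (word [Y2, Y2, t]))"
    if "y \<in> {Y1, Y2}" "y' \<in> {Y1, Y2}" for y y'
  proof -
    have "rd x y = (\<Sum>i\<in>YX. m (x, y) i \<cdot> pair_word i)"
      "\<And>l. l \<in> {X1, X2} \<Longrightarrow> rd l y' = (\<Sum>i\<in>YX. m (l, y') i \<cdot> pair_word i)"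
      using that x by (auto simp: reduct_def)
    then show ?thesis
      using that
      by (intro poly_mapping_eqI)
        (simp add: pair_word_def xyy_coeff_def lin swap sort' lookup_add lookup_scale algebra_simps)
  qed
  have "\<phi> (word [x] * rd Y2 Y1) = p\<^sub>1 \<cdot> \<phi> (rd x Y1 * word [Y2]) + p\<^sub>2 \<cdot> \<phi> (rd x Y1 * word [Y1])"
    by (simp add: reduct_def[of q p\<^sub>1 p\<^sub>2 m Y2 Y1] lin mid)
  also have "\<dots> = \<phi> (rd x Y2 * word [Y1])"
    using y_relation[OF x, of X1] y_relation[OF x, of X2]
    by (simp add: two_swaps falg.scale_right_distrib)
      (simp add: falg.scale_left_distrib algebra_simps)
  finally show ?thesis by simp
qed

sublocale quadratic_rewriting rd
proof
  show "length w = 2 \<and> sorted w \<and> w < [a, b]" if "b < a" "w \<in> Poly_Mapping.keys (rd a b)" for a b w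
    using that by (rule keys_rd)
  fix a b c :: letter and \<phi> :: "'k falg \<Rightarrow> 'k falg"
  assume less: "b < c" "a < b" and \<phi>: "flinear \<phi>"
    and rewr: "\<And>p d e q'. e < d \<Longrightarrow> length p + length q' = 1 \<Longrightarrow> p @ [d, e] @ q' < [c, b, a] \<Longrightarrow>
        \<phi> (word (p @ [d, e] @ q')) = \<phi> (word p * rd d e * word q')"
  have left: "\<phi> (word [d, e, z]) = \<phi> (rd d e * word [z])" if "e < d" "[d, e, z] < [c, b, a]" for d e z
    using rewr[of e d "[]" "[z]"] that by (simp add: word_Nil)
  have right: "\<phi> (word [z, d, e]) = \<phi> (word [z] * rd d e)" if "e < d" "[z, d, e] < [c, b, a]" for d e z
    using rewr[of e d "[z]" "[]"] that by (simp add: word_Nil)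
  consider (xxy) "c = X2" "b = X1" "a \<in> {Y1, Y2}" | (xyy) "c \<in> {X1, X2}" "b = Y2" "a = Y1"
    using less by (cases a; cases b; cases c) (simp_all add: less_letter_def)
  then show "\<phi> (rd c b * word [a]) = \<phi> (word [c] * rd b a)"
  proof cases
    case xxy
    then show ?thesis
      by (simp only: xxy(1,2), intro exchange_xxy \<phi>)
        (auto intro!: left right simp: less_letter_def Cons_less_Cons)
  next
    case xyy
    then show ?thesis
      by (simp only: xyy(2,3), intro exchange_xyy \<phi>)
        (auto intro!: left right simp: less_letter_def Cons_less_Cons)
  qed
qed

end

text \<open>If \<open>w\<^sub>j = \<Sum>\<^sub>i m\<^sub>j\<^sub>i v\<^sub>i\<close> holds modulo an ideal and \<open>n m\<close> is the identity matrix, then applying \<open>n\<close>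
  solves for the \<open>v\<^sub>i\<close>.\<close>

lemma inverse_relation:
  fixes v :: "'i \<Rightarrow> 'k::field falg"
  assumes "finite I" "i \<in> I" "\<And>i'. i' \<in> I \<Longrightarrow> (\<Sum>j\<in>J. n i j * m j i') = (if i = i' then 1 else 0)"
    and "\<And>j. j \<in> J \<Longrightarrow> w j - (\<Sum>i\<in>I. m j i \<cdot> v i) \<in> gen_ideal S"
  shows "v i - (\<Sum>j\<in>J. n i j \<cdot> w j) \<in> gen_ideal S"
proof -
  have "(\<Sum>j\<in>J. n i j \<cdot> (\<Sum>i'\<in>I. m j i' \<cdot> v i')) = (\<Sum>i'\<in>I. (\<Sum>j\<in>J. n i j * m j i') \<cdot> v i')"
    by (simp add: falg.scale_sum_right falg.scale_sum_left) (rule sum.swap)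
  also have "\<dots> = (\<Sum>i'\<in>I. if i = i' then v i' else 0)"
    by (rule sum.cong) (auto simp: assms(3))
  also have "\<dots> = v i" using assms(1,2) by simp
  finally have "v i - (\<Sum>j\<in>J. n i j \<cdot> w j) = - (\<Sum>j\<in>J. n i j \<cdot> (w j - (\<Sum>i\<in>I. m j i \<cdot> v i)))"
    by (simp add: falg.scale_right_diff_distrib sum_subtractf)
  moreover have "(\<Sum>j\<in>J'. n i j \<cdot> (w j - (\<Sum>i\<in>I. m j i \<cdot> v i))) \<in> gen_ideal S" if "J' \<subseteq> J" for J'
    using that by (induction J' rule: infinite_finite_induct)
      (auto intro!: gen_ideal_zero gen_ideal_add gen_ideal_scale assms(4))
  ultimately show ?thesis by (simp add: gen_ideal_minus)
qed

text \<open>The relations that the two presentations of an algebra have in common.\<close>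

definition sorting :: "'k::field \<Rightarrow> 'k \<Rightarrow> 'k \<Rightarrow> 'k falg set" where
  "sorting q p\<^sub>1 p\<^sub>2 =
    {word [X2, X1] - q \<cdot> word [X1, X2],
     word [Y2, Y1] - (p\<^sub>1 \<cdot> word [Y1, Y2] + p\<^sub>2 \<cdot> word [Y1, Y1])}"

definition exchanging ::
    "'k::field \<Rightarrow> 'k \<Rightarrow> 'k \<Rightarrow> (letter \<times> letter \<Rightarrow> letter \<times> letter \<Rightarrow> 'k) \<Rightarrow> 'k falg set" where
  "exchanging q p\<^sub>1 p\<^sub>2 n =
    sorting q p\<^sub>1 p\<^sub>2 \<union>
    (\<lambda>i. pair_word i - (\<Sum>j\<in>XY. n i j \<cdot> pair_word j)) ` YX"

lemma descent_relations_reduct: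
  "descent_relations (reduct q p\<^sub>1 p\<^sub>2 m) =
    sorting q p\<^sub>1 p\<^sub>2 \<union>
    (\<lambda>j. pair_word j - (\<Sum>i\<in>YX. m j i \<cdot> pair_word i)) ` XY"
proof -
  have "descent_relations (reduct q p\<^sub>1 p\<^sub>2 m) = 
      (\<lambda>(a, b). word [a, b] - reduct q p\<^sub>1 p\<^sub>2 m a b) ` {(a, b). b < a}"
    by (auto simp: descent_relations_def)
  then show ?thesis
    unfolding descents by (simp add: reduct_def pair_word_def sorting_def)
qed

lemma gen_ideal_exchanging:
  assumes "\<And>i i'. i \<in> YX \<Longrightarrow> i' \<in> YX \<Longrightarrow> (\<Sum>j\<in>XY. n i j * m j i') = (if i = i' then 1 else 0)"
    and "\<And>j j'. j \<in> XY \<Longrightarrow> j' \<in> XY \<Longrightarrow> (\<Sum>i\<in>YX. m j i * n i j') = (if j = j' then 1 else 0)"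
  shows "gen_ideal (exchanging q p\<^sub>1 p\<^sub>2 n) = gen_ideal (descent_relations (reduct q p\<^sub>1 p\<^sub>2 m))"
    (is "gen_ideal ?E = gen_ideal ?S")
proof (intro subset_antisym gen_ideal_subset)
  have S: "sorting q p\<^sub>1 p\<^sub>2 \<subseteq> gen_ideal ?S"
    "\<And>j. j \<in> XY \<Longrightarrow> pair_word j - (\<Sum>i\<in>YX. m j i \<cdot> pair_word i) \<in> gen_ideal ?S"
    using gen_ideal_superset[of ?S, THEN subsetD] unfolding descent_relations_reduct by blast+
  show "?E \<subseteq> gen_ideal ?S"
    unfolding exchanging_def
    by (intro Un_least image_subsetI S inverse_relation[where I = YX and m = m] assms(1)) simp_all
  have E: "sorting q p\<^sub>1 p\<^sub>2 \<subseteq> gen_ideal ?E"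
    "\<And>i. i \<in> YX \<Longrightarrow> pair_word i - (\<Sum>j\<in>XY. n i j \<cdot> pair_word j) \<in> gen_ideal ?E"
    using gen_ideal_superset[of ?E, THEN subsetD] unfolding exchanging_def by blast+
  show "?S \<subseteq> gen_ideal ?E"
    unfolding descent_relations_reduct
    by (intro Un_least image_subsetI E inverse_relation[where I = XY and m = n] assms(2)) simp_all
qed

section \<open>The twelve families\<close>

text \<open>Both kinds of pairs, \<open>YX\<close> and \<open>XY\<close>, index a table in their lexicographic order with \<open>Y1\<close>
  before \<open>Y2\<close> and \<open>X1\<close> before \<open>X2\<close>, so one access function serves rows and columns of either matrix.\<close>

fun entry :: "'b \<times> 'b \<times> 'b \<times> 'b \<Rightarrow> letter \<times> letter \<Rightarrow> 'b" where
  "entry (a, b, c, d) (u, v) =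
    (if u \<in> {X1, Y1} then if v \<in> {X1, Y1} then a else b
     else if v \<in> {X1, Y1} then c else d)"

type_synonym 'k table = "('k \<times> 'k \<times> 'k \<times> 'k) \<times> ('k \<times> 'k \<times> 'k \<times> 'k) \<times>
  ('k \<times> 'k \<times> 'k \<times> 'k) \<times> ('k \<times> 'k \<times> 'k \<times> 'k)"

definition matrix :: "'k table \<Rightarrow> letter \<times> letter \<Rightarrow> letter \<times> letter \<Rightarrow> 'k" where
  "matrix M i j = entry (entry M i) j"

fun x_coeff :: "'k::field family \<Rightarrow> 'k" where
  "x_coeff (FamB p) = p"
| "x_coeff (FamD p) = - 1"
| "x_coeff (FamE p) = - 1"
| "x_coeff (FamK q \<alpha>) = q"
| "x_coeff (FamL q \<alpha>) = q"
| "x_coeff FamQ = - 1"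
| "x_coeff FamR = - 1"
| "x_coeff _ = 1"

fun y_coeff :: "'k::field family \<Rightarrow> 'k" where
  "y_coeff FamA = 1"
| "y_coeff (FamB p) = p"
| "y_coeff (FamD p) = p"
| "y_coeff (FamE p) = p"
| "y_coeff (FamG p \<alpha>) = p"
| "y_coeff _ = - 1"

fun y_square_coeff :: "'k::field family \<Rightarrow> 'k" where
  "y_square_coeff FamA = 1"
| "y_square_coeff _ = 0"

text \<open>The rows belong to \<open>x\<^sub>1y\<^sub>1, x\<^sub>1y\<^sub>2, x\<^sub>2y\<^sub>1, x\<^sub>2y\<^sub>2\<close>, the columns to
  \<open>y\<^sub>1x\<^sub>1, y\<^sub>1x\<^sub>2, y\<^sub>2x\<^sub>1, y\<^sub>2x\<^sub>2\<close>; the entries are read off from \<open>S_set\<close>.\<close>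

fun straightening_table :: "'k::field family \<Rightarrow> 'k table" where
  "straightening_table FamA = ((1, 0, 0, 0), (0, 0, 1, 0), (0, 1, - 1, 0), (0, 2, - 1, 1))"
| "straightening_table (FamB p) = ((0, 0, 0, 1), (0, 1, 0, 0), (0, 0, - 1, 0), (1, 0, 0, 0))"
| "straightening_table (FamD p) = ((- p, 0, 0, 0), (0, 0, 1 / p, 0), (0, - 1, 1 / p, 0), (p, 0, 0, 1))"
| "straightening_table (FamE p) =
    ((0, 0, - (1 / 2), 1 / 2), (1 / 2, 1 / 2, 0, 0), (0, 0, 1 / 2, 1 / 2), (1 / 2, - (1 / 2), 0, 0))"
| "straightening_table (FamG p \<alpha>) =
    ((1 / p, 0, 0, 0), (0, 0, 1 / p, 0), (- (1 / p ^ 2), 1 / p ^ 2, - (1 / p ^ 3), 0),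
     (- (\<alpha> / p), 0, 1 / p, 1))"
| "straightening_table (FamK q \<alpha>) = ((1, 0, 0, 0), (0, 0, 1, 0), (0, 0, 0, 1 / \<alpha>), (0, 1, 0, 0))"
| "straightening_table (FamL q \<alpha>) = ((0, 0, 1 / \<alpha>, 0), (1 / \<alpha>, 0, 0, 0), (0, 0, 0, 1), (0, 1, 0, 0))"
| "straightening_table FamQ = ((0, 0, - 1, 0), (1, 0, 0, 0), (- 1, 1, 1, 0), (1, 0, 1, 1))"
| "straightening_table FamR = ((1, - 1, - 1, 0), (0, 1, 0, 0), (0, 0, 1, 0), (0, 1, 1, 1))"
| "straightening_table FamV = ((0, 1, - 1, 0), (1, - 1, 0, 0), (0, 1, 0, 0), (0, 0, 0, 1))"
| "straightening_table FamX = ((0, 0, 1, 0), (1, 0, 0, 0), (0, 0, - 1, 1), (- 1, 1, 0, 0))"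
| "straightening_table (FamY \<alpha>) = ((1, 0, 0, 0), (0, 0, 1, 0), (\<alpha>, - 1, 1, 0), (1, 0, \<alpha>, - 1))"

text \<open>Here the rows belong to the \<open>y\<^sub>kx\<^sub>l\<close> and the columns to the \<open>x\<^sub>iy\<^sub>j\<close>; the entries are read off from the defining relations.\<close>

fun exchange_table :: "'k::field family \<Rightarrow> 'k table" where
  "exchange_table FamA = ((1, 0, 0, 0), (0, 1, 1, 0), (0, 1, 0, 0), (0, - 1, - 2, 1))"
| "exchange_table (FamB p) = ((0, 0, 0, 1), (0, 1, 0, 0), (0, 0, - 1, 0), (1, 0, 0, 0))"
| "exchange_table (FamD p) = ((- p, 0, 0, 0), (0, 1, - (p ^ 2), 0), (0, p, 0, 0), (1, 0, 0, 1))"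
| "exchange_table (FamE p) = ((0, 1, 0, 1), (0, 1, 0, - 1), (- 1, 0, 1, 0), (1, 0, 1, 0))"
| "exchange_table (FamG p \<alpha>) = ((p, 0, 0, 0), (p, 1, p ^ 2, 0), (0, p, 0, 0), (\<alpha>, - 1, 0, 1))"
| "exchange_table (FamK q \<alpha>) = ((1, 0, 0, 0), (0, 0, 0, 1), (0, 1, 0, 0), (0, 0, \<alpha>, 0))"
| "exchange_table (FamL q \<alpha>) = ((0, \<alpha>, 0, 0), (0, 0, 0, 1), (\<alpha>, 0, 0, 0), (0, 0, 1, 0))"
| "exchange_table FamQ = ((0, 1, 0, 0), (1, 1, 1, 0), (- 1, 0, 0, 0), (1, - 1, 0, 1))"
| "exchange_table FamR = ((1, 1, 1, 0), (0, 1, 0, 0), (0, 0, 1, 0), (0, - 1, - 1, 1))"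
| "exchange_table FamV = ((0, 1, 1, 0), (0, 0, 1, 0), (- 1, 0, 1, 0), (0, 0, 0, 1))"
| "exchange_table FamX = ((0, 1, 0, 0), (0, 1, 0, 1), (1, 0, 0, 0), (1, 0, 1, 0))"
| "exchange_table (FamY \<alpha>) = ((1, 0, 0, 0), (\<alpha>, 1, - 1, 0), (0, 1, 0, 0), (1, \<alpha>, 0, - 1))"

lemma tables_inverse:
  assumes "admissible F"
  shows "i \<in> YX \<Longrightarrow> i' \<in> YX \<Longrightarrow>
      (\<Sum>j\<in>XY. matrix (exchange_table F) i j * matrix (straightening_table F) j i') = (if i = i' then 1 else 0)"
    and "j \<in> XY \<Longrightarrow> j' \<in> XY \<Longrightarrow>
      (\<Sum>i\<in>YX. matrix (straightening_table F) j i * matrix (exchange_table F) i j') = (if j = j' then 1 else 0)"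
  using assms by (cases F; auto simp: matrix_def field_simps power2_eq_square power3_eq_cube)+

lemma S_set_eq:
  assumes "admissible F"
  shows "S_set F = descent_relations
    (reduct (x_coeff F) (y_coeff F) (y_square_coeff F) (matrix (straightening_table F)))"
  unfolding descent_relations_reduct sorting_def
  using assms by (cases F) (simp_all add: matrix_def pair_word_def word_mult algebra_simps power2_eq_square insert_commute)

lemma defining_relations_eq:
  assumes "admissible F"
  shows "defining_relations F = exchanging (x_coeff F) (y_coeff F) (y_square_coeff F) (matrix (exchange_table F))"
  unfolding exchanging_def sorting_def
  using assms by (cases F) (simp_all add: matrix_def pair_word_def word_mult algebra_simps power2_eq_square insert_commute)

lemma twisted_product_family:
  fixes F :: "'k::field family"
  assumes "admissible F"
  shows "twisted_product (x_coeff F) (y_coeff F) (y_square_coeff F) (matrix (straightening_table F))"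
proof -
  note coeff_defs = xxy_coeff_def xyy_coeff_def matrix_def
  show ?thesis
  proof (cases F)
    case (FamE p)
    then have p: "p * p = - 1" and two: "(2::'k) \<noteq> 0"
      using assms by (auto simp: power2_eq_square)
    \<comment> \<open>clearing denominators produces powers of \<open>2\<close> on both sides\<close>
    have "(4::'k) = 2 * 2" by simp
    then have four: "(4::'k) \<noteq> 0" using two by (metis mult_eq_0_iff)
    have p_left: "p * (p * c) = - c" for c
      using p by (simp flip: mult.assoc)
    show ?thesis
      using FamE two four
      by unfold_locales (auto simp: coeff_defs field_simps p p_left)
  next
    case FamA
    then show ?thesis
      using assms by unfold_locales (auto simp: coeff_defs field_simps power2_eq_square)
  next
    case FamB
    then show ?thesis
      using assms by unfold_locales (auto simp: coeff_defs field_simps power2_eq_square)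
  next
    case FamD
    then show ?thesis
      using assms by unfold_locales (auto simp: coeff_defs field_simps power2_eq_square)
  next
    case FamK
    then show ?thesis
      using assms by unfold_locales (auto simp: coeff_defs field_simps power2_eq_square)
  next
    case FamL
    then show ?thesis
      using assms by unfold_locales (auto simp: coeff_defs field_simps power2_eq_square)
  next
    case FamG
    then show ?thesis
      using assms by unfold_locales (auto simp: coeff_defs field_simps power2_eq_square power3_eq_cube)
  next
    case FamQ
    then show ?thesis
      using assms by unfold_locales (auto simp: coeff_defs)
  next
    case FamR
    then show ?thesis
      using assms by unfold_locales (auto simp: coeff_defs)
  next
    case FamV
    then show ?thesis
      using assms by unfold_locales (auto simp: coeff_defs)
  next
    case FamX
    then show ?thesis
      using assms by unfold_locales (auto simp: coeff_defs)
  next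
    case FamY
    then show ?thesis
      using assms by unfold_locales (auto simp: coeff_defs algebra_simps)
  qed
qed

theorem mainTheorem13:
  fixes F :: "'k::field family"
  assumes "admissible F"
  shows "card (S_set F) = 6 \<and> (\<forall>s\<in>S_set F. monic s) \<and>
    gen_ideal (defining_relations F) = gen_ideal (S_set F) \<and>
    Irr (S_set F) =
      {replicate i\<^sub>1 Y1 @ replicate i\<^sub>2 Y2 @ replicate i\<^sub>3 X1 @ replicate i\<^sub>4 X2 | i\<^sub>1 i\<^sub>2 i\<^sub>3 i\<^sub>4. True} \<and>
    inj_on (\<lambda>u. proj (S_set F) (word u)) (Irr (S_set F)) \<and>
    vectorspace.basis (class_ring :: 'k ring) (presented_algebra (S_set F))
      ((\<lambda>u. proj (S_set F) (word u)) ` Irr (S_set F)) \<and>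
    PBW_basis (presented_algebra (S_set F)) (map (proj (S_set F)) [y\<^sub>1, y\<^sub>2, x\<^sub>1, x\<^sub>2])
      ((\<lambda>u. proj (S_set F) (word u)) ` Irr (S_set F))"
proof -
  interpret twisted_product "x_coeff F" "y_coeff F" "y_square_coeff F" "matrix (straightening_table F)"
    using assms by (rule twisted_product_family)
  have S: "S_set F = relations"
    by (rule S_set_eq[OF assms])
  have "gen_ideal (defining_relations F) = gen_ideal (S_set F)"
    unfolding S_set_eq[OF assms] defining_relations_eq[OF assms]
    by (rule gen_ideal_exchanging) (rule tables_inverse[OF assms]; assumption)+
  moreover have "\<forall>s\<in>relations. monic s"
    by (auto simp: descent_relations_def leading_relation)
  moreover have "{w :: letter list. sorted w} =
      {replicate i\<^sub>1 Y1 @ replicate i\<^sub>2 Y2 @ replicate i\<^sub>3 X1 @ replicate i\<^sub>4 X2 | i\<^sub>1 i\<^sub>2 i\<^sub>3 i\<^sub>4. True}"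
    by (auto simp: sorted_letter_iff)
  ultimately show ?thesis
    unfolding S using card_relations Irr_relations inj_on_sorted basis_sorted
      PBW_basisI[OF inj_on_sorted basis_sorted]
    by (simp only: simp_thms)
qed

end
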